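(* Let $\mathcal{D}=\{\alpha_1,\ldots,\alpha_m\}$ be a dissection of a convex $n$-gon $P_n$ of type $\{d_1,\ldots,d_m\}$, with associated indeterminates $x_1,\ldots,x_m$, respectively, and indeterminate weights $q_1,\ldots,q_n$ on the edges $e_1,\ldots,e_n$. Let $R=\mathbb{Z}[x_1^{\pm},\ldots,x_m^{\pm};q_1^{\pm},\ldots,q_n^{\pm}]$ be the ring of Laurent polynomials in these indeterminates. Set $c=\prod_{i=1}^m x_i^{d_i-2}$ and $\varepsilon=\prod_{i=1}^n q_i$. Let $W_{\mathcal{D}}(x;q)=W_{\mathcal{D}}(x_1,\ldots,x_m;q_1,\ldots,q_n)$ be the weight matrix corresponding to $\mathcal{D}$. Then $$\det W_{\mathcal{D}}(x;q)=(-1)^{n-1}\varepsilon\prod_{i=1}^m\sum_{j=0}^{d_i-2}(\varepsilon c x_i^2)^j=(-1)^{n-1}\varepsilon\prod_{i=1}^m\frac{(\varepsilon c x_i^2)^{d_i-1}-1}{\varepsilon c x_i^2-1}.$$ Furthermore, there are matrices $P,Q\in\mathrm{GL}(n,R)$ such that $$P\cdot W_{\mathcal{D}}(x;q)\cdot Q=\Delta\left(\sum_{j=0}^{d_1-2}(\varepsilon c x_1^2)^j,\ldots,\sum_{j=0}^{d_m-2}(\varepsilon c x_m^2)^j,1,\ldots,1\right).$$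
   Context: $P_n$ is a convex $n$-gon ($n\ge3$) with vertices labelled $1,2,\ldots,n$ in counterclockwise order, labels being taken modulo $n$. A dissection $\mathcal{D}$ of $P_n$ is obtained by drawing $m-1$ ($m\ge 1$) pairwise noncrossing diagonals, which cut $P_n$ into $m$ polygons $\alpha_1,\ldots,\alpha_m$, called the pieces of the dissection; one writes $\mathcal{D}=\{\alpha_1,\ldots,\alpha_m\}$. If $\alpha_l$ has $d_l$ vertices, it is called a piece of degree $d_l$; the multiset $\{d_1,\ldots,d_m\}$ is the type of $\mathcal{D}$. For vertices $i,j$, a (counterclockwise) walk from $i$ to $j$ around $P_n$ is a sequence $w=(p_{i+1},p_{i+2},\ldots,p_{j-1})$ of pieces of $\mathcal{D}$, indexed by the vertices strictly between $i$ and $j$ when going counterclockwise from $i$ to $j$ (labels modulo $n$), such that: (i) $p_k$ is incident to vertex $k$ (i.e. $k$ is a vertex of $p_k$) for all $k\in\{i+1,\ldots,j-1\}$; (ii) each piece $\alpha\in\mathcal{D}$ of degree $d$ appears at most $d-2$ times among $p_{i+1},\ldots,p_{j-1}$. By convention, for $i=j$ there is no walk from $i$ to $i$; for $j=i+1$ (modulo $n$) the empty sequence is the unique walk from $i$ to $i+1$. To each piece $\alpha_l$ an indeterminate $x_l=x(\alpha_l)$ is associated, and to each boundary edge $e_i$ of $P_n$ joining $i$ and $i+1$ (modulo $n$) an indeterminate $q_i$. The weight of a walk $w=(p_{i+1},\ldots,p_{j-1})$ from $i$ to $j$ is the monomial $x^wq^w$ with $x^w=\prod_{k=i+1}^{j-1}x(p_k)$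 and $q^w=\prod_{s=i}^{j-1}q_s$ (products taken counterclockwise from $i$ to $j$, indices modulo $n$; so $q^w$ is the product of the weights of the edges traversed). The weight matrix $W_{\mathcal{D}}(x;q)=(v_{i,j})_{1\le i,j\le n}$ has entries $v_{i,j}=\sum_w x^wq^w$, the sum over all walks $w$ from $i$ to $j$ (so $v_{i,i}=0$, $v_{i,i+1}=q_i$). $\Delta(a_1,\ldots,a_n)$ denotes the diagonal matrix with diagonal entries $a_1,\ldots,a_n$. *)

theory Defs
  imports
    "Jordan_Normal_Form.Determinant"
    "HOL-Library.Poly_Mapping"
    "HOL-Computational_Algebra.Polynomial_Factorial"
begin

text \<open>
  The vertices of the \<open>n\<close>-gon are \<open>0, \<dots>, n - 1\<close> in counterclockwise order, i.e. the usual
  labels \<open>1, \<dots>, n\<close> shifted by one, so that they coincide with the matrix indices.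
  A diagonal with end points \<open>a < b\<close> is the pair \<open>(a, b)\<close>; a polygon spanned by vertices of the
  \<open>n\<close>-gon is represented by its set of vertices.
\<close>

definition diagonals :: "nat \<Rightarrow> (nat \<times> nat) set" where
  "diagonals n = {(a, b). a + 1 < b \<and> b < n \<and> (a, b) \<noteq> (0, n - 1)}"

definition crossing :: "nat \<times> nat \<Rightarrow> nat \<times> nat \<Rightarrow> bool" where
  "crossing e f \<longleftrightarrow>
     (fst e < fst f \<and> fst f < snd e \<and> snd e < snd f) \<or>
     (fst f < fst e \<and> fst e < snd f \<and> snd f < snd e)"

definition dissection :: "nat \<Rightarrow> (nat \<times> nat) set \<Rightarrow> bool" where
  "dissection n E \<longleftrightarrow> E \<subseteq> diagonals n \<and> (\<forall>e\<in>E. \<forall>f\<in>E. \<not> crossing e f)"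

text \<open>The two polygons into which a single diagonal cuts the \<open>n\<close>-gon.\<close>

definition sides :: "nat \<Rightarrow> nat \<times> nat \<Rightarrow> nat set set" where
  "sides n e = {{fst e..snd e}, {..<n} - {fst e<..<snd e}}"

text \<open>
  A piece is a nondegenerate region cut out by the diagonals: it lies on one chosen side \<open>H e\<close> of
  every diagonal \<open>e\<close>. Side choices that do not bound a polygon yield fewer than three vertices.
\<close>

definition pieces :: "nat \<Rightarrow> (nat \<times> nat) set \<Rightarrow> nat set set" where
  "pieces n E =
     {A. 3 \<le> card A \<and> (\<exists>H. (\<forall>e\<in>E. H e \<in> sides n e) \<and> A = {..<n} \<inter> (\<Inter>e\<in>E. H e))}"

text \<open>The number of edges passed when going counterclockwise from \<open>i\<close> to \<open>j\<close>.\<close>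

definition ccw_dist :: "nat \<Rightarrow> nat \<Rightarrow> nat \<Rightarrow> nat" where
  "ccw_dist n i j = (n + j - i) mod n"

text \<open>
  The walks from \<open>i\<close> to \<open>j\<close>, where \<open>D\<close> is the set of pieces. The entry \<open>w ! t\<close> of a walk is the
  piece attached to the vertex \<open>i + 1 + t\<close> (modulo \<open>n\<close>).
\<close>

definition walks :: "nat \<Rightarrow> nat set set \<Rightarrow> nat \<Rightarrow> nat \<Rightarrow> nat set list set" where
  "walks n D i j =
     (if i = j then {} else
       {w. length w = ccw_dist n i j - 1 \<and> set w \<subseteq> D \<and>
           (\<forall>t<length w. (i + 1 + t) mod n \<in> w ! t) \<and>
           (\<forall>A\<in>D. count_list w A \<le> card A - 2)})"

text \<open>
  \<open>x A\<close> is the weight of the piece \<open>A\<close> and \<open>q i\<close> the weight of the edge joining \<open>i\<close> and \<open>i + 1\<close>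
  (modulo \<open>n\<close>).
\<close>

definition walk_weight ::
  "nat \<Rightarrow> (nat set \<Rightarrow> 'a) \<Rightarrow> (nat \<Rightarrow> 'a) \<Rightarrow> nat \<Rightarrow> nat \<Rightarrow> nat set list \<Rightarrow> 'a::comm_ring_1" where
  "walk_weight n x q i j w =
     (\<Prod>t<length w. x (w ! t)) * (\<Prod>s<ccw_dist n i j. q ((i + s) mod n))"

definition weight_matrix ::
  "nat \<Rightarrow> nat set set \<Rightarrow> (nat set \<Rightarrow> 'a) \<Rightarrow> (nat \<Rightarrow> 'a) \<Rightarrow> 'a::comm_ring_1 mat" where
  "weight_matrix n D x q =
     Matrix.mat n n (\<lambda>(i, j). \<Sum>w\<in>walks n D i j. walk_weight n x q i j w)"

datatype indet = XVar nat | QVar nat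

text \<open>
  The linear order on the indeterminates is arbitrary. It serves only to obtain, from the instances
  for \<open>poly_mapping\<close>, that Laurent polynomials form an integral domain.
\<close>

primrec indet_rank :: "indet \<Rightarrow> nat" where
  "indet_rank (XVar l) = 2 * l"
| "indet_rank (QVar i) = 2 * i + 1"

lemma indet_rank_eq_iff: "indet_rank u = indet_rank v \<longleftrightarrow> u = v"
  by (cases u; cases v) (simp_all, presburger+)

instantiation indet :: linorder
begin

definition less_eq_indet :: "indet \<Rightarrow> indet \<Rightarrow> bool" where
  "u \<le> v \<longleftrightarrow> indet_rank u \<le> indet_rank v"

definition less_indet :: "indet \<Rightarrow> indet \<Rightarrow> bool" where
  "u < v \<longleftrightarrow> indet_rank u < indet_rank v"

instance
  by standard (auto simp: less_eq_indet_def less_indet_def indet_rank_eq_iff)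

end

text \<open>
  Integral Laurent polynomials in the countably many indeterminates \<open>XVar l\<close>, \<open>QVar i\<close>: the inner
  \<open>\<Rightarrow>\<^sub>0\<close> is the group of exponent vectors, the outer one the group ring over it.
\<close>

type_synonym laurent = "(indet \<Rightarrow>\<^sub>0 int) \<Rightarrow>\<^sub>0 int"

definition Var :: "indet \<Rightarrow> laurent" where
  "Var v = Poly_Mapping.single (Poly_Mapping.single v 1) 1"

text \<open>The subring of Laurent polynomials in \<open>x\<^sub>0, \<dots>, x\<^bsub>m-1\<^esub>, q\<^sub>0, \<dots>, q\<^bsub>n-1\<^esub>\<close> only.\<close>

definition laurent_ring :: "nat \<Rightarrow> nat \<Rightarrow> laurent set" where
  "laurent_ring m n =
     {f. \<forall>e \<in> Poly_Mapping.keys f. Poly_Mapping.keys e \<subseteq> XVar ` {..<m} \<union> QVar ` {..<n}}"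

definition mats_over :: "nat \<Rightarrow> 'a set \<Rightarrow> 'a mat set" where
  "mats_over n R = {A \<in> carrier_mat n n. elements_mat A \<subseteq> R}"

text \<open>\<open>R\<close> is a subring of the type \<open>'a\<close>; the inverse is required to have its entries in \<open>R\<close>, too.\<close>

definition GL :: "nat \<Rightarrow> 'a::comm_ring_1 set \<Rightarrow> 'a mat set" where
  "GL n R = {A \<in> mats_over n R. \<exists>B \<in> mats_over n R. A * B = 1\<^sub>m n \<and> B * A = 1\<^sub>m n}"

end

(*
Remove from the polygon an ear: a piece B that is cut off by a single diagonal ab. Every vertex of B
other than a and b lies in no other piece, so a walk between the rest V and such a vertex either
uses B at the end of the diagonal or does not. Hence the columns (and rows) of W indexed by
C = B - {a, b} restricted to V are combinations of the columns (rows) a and b, and elimination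
splits W into the part indexed by V and a Schur complement indexed by C. The former is, up to a
diagonal conjugation, the weight matrix of the remaining dissection with epsilon replaced by
epsilon * x(B)^(d-2), which leaves epsilon * c unchanged. The latter is, up to units, the matrix with
entries z above, 1 + z on and 1 below the diagonal, where z = epsilon * c * x(B)^2; it is equivalent
to diag(1 + z + ... + z^(d-2), 1, ..., 1). Induction ends with a digon, whose matrix is invertible.
*)

theory Submission
  imports Defs
begin

subsection \<open>Equivalence of matrices over a subring\<close>

text \<open>Everything rests on one count: the capacities \<open>card A - 2\<close> of the pieces
  add up to two less than the number of vertices. Hence no filling covers all vertices but one, and
  the zero diagonal needs no exception. A walk that runs around all of V on its way between two
  vertices of C asks too much of the old pieces unless a and b both go to B; this is the source of
  the factor x(B)^2 in z. The remaining vertices of V then use every old piece to capacity, which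
  contributes the single monomial c of the smaller dissection. The second coincidence is that B has
  as many new vertices as capacity, namely d - 2. A walk over all of C exhausts B, so it sees the
  diagonal ab as an edge of weight x(B)^(d-2). This power has to be divided out before the columns a
  and b can cancel the columns in C, and that is where invertible indeterminates enter. The
  equivalences used in the induction preserve determinants, so a single induction serves both
  claims; the units on the diagonal are removed only at the very end.\<close>

locale subring_of =
  fixes R :: "'a::comm_ring_1 set"
  assumes zero_in: "0 \<in> R" and one_in: "1 \<in> R"
    and add_in: "a \<in> R \<Longrightarrow> b \<in> R \<Longrightarrow> a + b \<in> R"
    and mult_in: "a \<in> R \<Longrightarrow> b \<in> R \<Longrightarrow> a * b \<in> R"
    and uminus_in: "a \<in> R \<Longrightarrow> - a \<in> R"
begin

lemma power_in: "a \<in> R \<Longrightarrow> a ^ k \<in> R"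
  by (induction k) (auto intro: one_in mult_in)

lemma sum_in: "(\<And>k. k \<in> S \<Longrightarrow> f k \<in> R) \<Longrightarrow> sum f S \<in> R"
  by (induction S rule: infinite_finite_induct) (auto intro: zero_in add_in)

text \<open>Invertibility inside \<open>R\<close> rather than in the ambient ring: inverses of units
  become entries of the transforming matrices, which must stay in \<open>R\<close>.\<close>

definition unit_in :: "'a \<Rightarrow> bool" where
  "unit_in u \<longleftrightarrow> u \<in> R \<and> (\<exists>v\<in>R. u * v = 1)"

lemma unit_in_obtain:
  assumes "unit_in u"
  obtains v where "u \<in> R" "v \<in> R" "u * v = 1" "v * u = 1" "unit_in v"
  using assms unfolding unit_in_def by (metis mult.commute)

lemma unit_in_one: "unit_in 1"
  unfolding unit_in_def using one_in by auto

lemma unit_in_mult: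
  assumes "unit_in a" "unit_in b"
  shows "unit_in (a * b)"
proof -
  from assms obtain a' b' where *: "a \<in> R" "b \<in> R" "a' \<in> R" "b' \<in> R" "a * a' = 1" "b * b' = 1"
    unfolding unit_in_def by auto
  have "(a * b) * (a' * b') = (a * a') * (b * b')" by (simp only: mult_ac)
  with * show ?thesis unfolding unit_in_def by (intro conjI bexI[of _ "a' * b'"]) (auto intro: mult_in)
qed

lemma unit_in_uminus: "unit_in a \<Longrightarrow> unit_in (- a)"
  unfolding unit_in_def by (metis minus_mult_minus uminus_in)

lemma unit_in_power: "unit_in a \<Longrightarrow> unit_in (a ^ k)"
  by (induction k) (auto intro: unit_in_one unit_in_mult)

lemma unit_in_prod: "(\<And>k. k \<in> S \<Longrightarrow> unit_in (f k)) \<Longrightarrow> unit_in (prod f S)"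
  by (induction S rule: infinite_finite_induct) (auto intro: unit_in_one unit_in_mult)

lemma mats_overI:
  "A \<in> carrier_mat n n \<Longrightarrow> (\<And>i j. i < n \<Longrightarrow> j < n \<Longrightarrow> A $$ (i, j) \<in> R) \<Longrightarrow> A \<in> mats_over n R"
  unfolding mats_over_def by auto

lemma mats_overD: "A \<in> mats_over n R \<Longrightarrow> i < n \<Longrightarrow> j < n \<Longrightarrow> A $$ (i, j) \<in> R"
  unfolding mats_over_def by auto

lemma mats_over_carrier: "A \<in> mats_over n R \<Longrightarrow> A \<in> carrier_mat n n"
  unfolding mats_over_def by auto

lemma mats_over_mult:
  assumes "A \<in> mats_over n R" "B \<in> mats_over n R"
  shows "A * B \<in> mats_over n R"
proof (rule mats_overI)
  note c = assms[THEN mats_over_carrier]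
  then show "A * B \<in> carrier_mat n n" by auto
  fix i j assume "i < n" "j < n"
  with c assms show "(A * B) $$ (i, j) \<in> R"
    by (auto simp: scalar_prod_def intro!: sum_in mult_in mats_overD)
qed

lemma GL_I:
  "A \<in> mats_over n R \<Longrightarrow> B \<in> mats_over n R \<Longrightarrow> A * B = 1\<^sub>m n \<Longrightarrow> B * A = 1\<^sub>m n \<Longrightarrow> A \<in> GL n R"
  unfolding GL_def by auto

lemma GL_carrier: "A \<in> GL n R \<Longrightarrow> A \<in> carrier_mat n n"
  unfolding GL_def by (auto dest: mats_over_carrier)

lemma GL_mult:
  assumes "A \<in> GL n R" "B \<in> GL n R"
  shows "A * B \<in> GL n R"
proof -
  from assms obtain A' B' where
    A: "A \<in> mats_over n R" "A' \<in> mats_over n R" "A * A' = 1\<^sub>m n" "A' * A = 1\<^sub>m n" and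
    B: "B \<in> mats_over n R" "B' \<in> mats_over n R" "B * B' = 1\<^sub>m n" "B' * B = 1\<^sub>m n"
    unfolding GL_def by auto
  have c: "A \<in> carrier_mat n n" "A' \<in> carrier_mat n n" "B \<in> carrier_mat n n" "B' \<in> carrier_mat n n"
    using A B by (auto dest: mats_over_carrier)
  have "(A * B) * (B' * A') = A * ((B * B') * A')"
    using c by (smt (verit) assoc_mult_mat mult_carrier_mat)
  also have "\<dots> = 1\<^sub>m n" using c A B by simp
  finally have 1: "(A * B) * (B' * A') = 1\<^sub>m n" .
  have "(B' * A') * (A * B) = B' * ((A' * A) * B)"
    using c by (smt (verit) assoc_mult_mat mult_carrier_mat)
  also have "\<dots> = 1\<^sub>m n" using c A B by simp
  finally have 2: "(B' * A') * (A * B) = 1\<^sub>m n" .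
  show ?thesis by (rule GL_I[OF _ _ 1 2]) (intro mats_over_mult A B)+
qed

lemma GL_one: "1\<^sub>m n \<in> GL n R"
  by (rule GL_I[of _ _ "1\<^sub>m n"]) (auto intro!: mats_overI zero_in one_in)

lemma GL_mat_diag:
  assumes "\<And>i. i < n \<Longrightarrow> u i \<in> R" "\<And>i. i < n \<Longrightarrow> u' i \<in> R" "\<And>i. i < n \<Longrightarrow> u i * u' i = 1"
  shows "mat_diag n u \<in> GL n R"
proof (rule GL_I[of _ _ "mat_diag n u'"])
  show "mat_diag n u * mat_diag n u' = 1\<^sub>m n" "mat_diag n u' * mat_diag n u = 1\<^sub>m n"
    using assms by (simp_all only: mat_diag_diag mat_diag_one[symmetric])
      (auto simp: mat_diag_def mult.commute intro!: eq_matI)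
qed (use assms in \<open>auto intro!: mats_overI zero_in simp: mat_diag_def\<close>)

lemma GL_addrow_mat:
  assumes "k < n" "l < n" "k \<noteq> l" "a \<in> R"
  shows "addrow_mat n a k l \<in> GL n R"
  by (rule GL_I[of _ _ "addrow_mat n (- a) k l"])
    (use assms addrow_mat_inv[OF assms(1-3), of a] addrow_mat_inv[OF assms(1-3), of "- a"] in
      \<open>auto intro!: mats_overI zero_in one_in add_in uminus_in\<close>)

end

lemma det_mat_diag: "det (mat_diag n u) = (\<Prod>i<n. u i :: 'a::comm_ring_1)"
proof -
  have "det (mat_diag n u) = prod_list (diag_mat (mat_diag n u))"
    by (rule det_upper_triangular[of _ n]) (auto simp: mat_diag_def)
  also have "diag_mat (mat_diag n u) = map u [0..<n]"
    unfolding diag_mat_def by (rule map_cong) (auto simp: mat_diag_def)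
  also have "prod_list \<dots> = (\<Prod>i<n. u i)"
    by (simp add: prod.distinct_set_conv_list[symmetric] atLeast0LessThan)
  finally show ?thesis .
qed

text \<open>Index functions allow each elimination step to be written pointwise; \<open>fmat\<close>
  forgets their values outside the range.\<close>

definition fmat :: "nat \<Rightarrow> (nat \<Rightarrow> nat \<Rightarrow> 'a) \<Rightarrow> 'a mat" where
  "fmat n M = Matrix.mat n n (\<lambda>(i, j). M i j)"

lemma fmat_carrier [simp]: "fmat n M \<in> carrier_mat n n"
  and fmat_dim [simp]: "dim_row (fmat n M) = n" "dim_col (fmat n M) = n"
  and fmat_index [simp]: "i < n \<Longrightarrow> j < n \<Longrightarrow> fmat n M $$ (i, j) = M i j"
  unfolding fmat_def by auto

lemma fmat_cong: "(\<And>i j. i < n \<Longrightarrow> j < n \<Longrightarrow> M i j = N i j) \<Longrightarrow> fmat n M = fmat n N"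
  by (rule eq_matI) auto

section \<open>Determinant-preserving equivalence and elementary operations\<close>

context subring_of
begin

text \<open>The condition on the determinants makes equivalent matrices have equal determinants.\<close>

definition eqv :: "nat \<Rightarrow> (nat \<Rightarrow> nat \<Rightarrow> 'a) \<Rightarrow> (nat \<Rightarrow> nat \<Rightarrow> 'a) \<Rightarrow> bool" where
  "eqv n M N \<longleftrightarrow> (\<exists>P\<in>GL n R. \<exists>Q\<in>GL n R. det P * det Q = 1 \<and> P * fmat n M * Q = fmat n N)"

lemma eqvI:
  "P \<in> GL n R \<Longrightarrow> Q \<in> GL n R \<Longrightarrow> det P * det Q = 1 \<Longrightarrow> P * fmat n M * Q = fmat n N \<Longrightarrow> eqv n M N"
  unfolding eqv_def by blast

lemma eqv_cong:
  assumes "\<And>i j. i < n \<Longrightarrow> j < n \<Longrightarrow> M i j = N i j"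
  shows "eqv n M N"
  using GL_one fmat_cong[of n M N, OF assms] by (intro eqvI[of "1\<^sub>m n" _ "1\<^sub>m n"]) auto

lemma eqv_trans [trans]:
  assumes "eqv n M N" "eqv n N L"
  shows "eqv n M L"
proof -
  from assms(1) obtain P Q where 1: "P \<in> GL n R" "Q \<in> GL n R" "det P * det Q = 1"
    "P * fmat n M * Q = fmat n N" unfolding eqv_def by auto
  from assms(2) obtain P' Q' where 2: "P' \<in> GL n R" "Q' \<in> GL n R" "det P' * det Q' = 1"
    "P' * fmat n N * Q' = fmat n L" unfolding eqv_def by auto
  note c = 1(1,2)[THEN GL_carrier] 2(1,2)[THEN GL_carrier]
  have "(P' * P) * fmat n M * (Q * Q') = P' * (P * fmat n M * Q) * Q'"
    using c by (smt (verit) assoc_mult_mat mult_carrier_mat fmat_carrier)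
  moreover have "det (P' * P) * det (Q * Q') = (det P' * det Q') * (det P * det Q)"
    using c by (simp add: det_mult mult_ac)
  ultimately show ?thesis 
    using 1 2 by (intro eqvI[of "P' * P" _ "Q * Q'"]) (auto intro: GL_mult)
qed

lemma eqv_cong_trans:
  assumes "eqv n M N" "\<And>i j. i < n \<Longrightarrow> j < n \<Longrightarrow> N i j = L i j"
  shows "eqv n M L"
  using assms eqv_cong eqv_trans by blast

lemma eqv_add_row:
  assumes "k < n" "l < n" "k \<noteq> l" "a \<in> R"
  shows "eqv n M (\<lambda>i j. if i = k then M i j + a * M l j else M i j)"
proof (rule eqvI[of "addrow_mat n a k l" _ "1\<^sub>m n"])
  have "addrow_mat n a k l * fmat n M = addrow a k l (fmat n M)"
    using addrow_mat[of "fmat n M" n n l a k] assms by simp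
  also have "\<dots> = fmat n (\<lambda>i j. if i = k then M i j + a * M l j else M i j)"
    using assms by (intro eq_matI) auto
  finally show "addrow_mat n a k l * fmat n M * 1\<^sub>m n = \<dots>" by simp
qed (use assms GL_addrow_mat GL_one det_addrow_mat in auto)

lemma eqv_add_col:
  assumes "k < n" "l < n" "k \<noteq> l" "a \<in> R"
  shows "eqv n M (\<lambda>i j. if j = k then M i j + a * M i l else M i j)"
proof (rule eqvI[of "1\<^sub>m n" _ "addrow_mat n a l k"])
  have "fmat n M * addrow_mat n a l k = addcol a k l (fmat n M)"
    using addcol_mat[of "fmat n M" n n l a k] assms by simp
  also have "\<dots> = fmat n (\<lambda>i j. if j = k then M i j + a * M i l else M i j)"
    using assms by (intro eq_matI) auto
  finally show "1\<^sub>m n * fmat n M * addrow_mat n a l k = \<dots>" by simp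
qed (use assms GL_addrow_mat GL_one det_addrow_mat[of l k n a] in auto)

text \<open>A conjugation rather than two independent scalings: \<open>u'\<close> inverts
  \<open>u\<close> entrywise, so the two determinants cancel as \<open>eqv\<close> demands.\<close>

lemma eqv_scale:
  assumes "\<And>i. i < n \<Longrightarrow> u i \<in> R" "\<And>i. i < n \<Longrightarrow> u' i \<in> R" "\<And>i. i < n \<Longrightarrow> u i * u' i = 1"
  shows "eqv n M (\<lambda>i j. u i * M i j * u' j)"
proof (rule eqvI[of "mat_diag n u" _ "mat_diag n u'"])
  show "det (mat_diag n u) * det (mat_diag n u') = 1"
    using assms(3) by (simp add: det_mat_diag prod.distrib[symmetric])
  have "mat_diag n u * fmat n M * mat_diag n u' =
    fmat n (\<lambda>i j. u i * M i j) * mat_diag n u'"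
    by (subst mat_diag_mult_left[of _ n n]) (auto intro!: arg_cong[of _ _ "\<lambda>X. X * _"] eq_matI)
  also have "\<dots> = fmat n (\<lambda>i j. u i * M i j * u' j)"
    by (subst mat_diag_mult_right[of _ n n]) (auto intro!: eq_matI simp: fmat_def)
  finally show "mat_diag n u * fmat n M * mat_diag n u' = \<dots>" .
  show "mat_diag n u \<in> GL n R" by (rule GL_mat_diag[of n u u']) (use assms in auto)
  show "mat_diag n u' \<in> GL n R" by (rule GL_mat_diag[of n u' u]) (use assms in \<open>auto simp: mult.commute\<close>)
qed

text \<open>Source rows \<open>S\<close> and target rows \<open>K\<close> are disjoint, so the
  sources never change and the single additions can be done in any order with a closed formula for
  the result.\<close>

lemma eqv_row_combination:
  assumes "S \<subseteq> {..<n}" "K \<subseteq> {..<n}" "K \<inter> S = {}" "\<And>i l. i \<in> K \<Longrightarrow> l \<in> S \<Longrightarrow> X i l \<in> R"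
  shows "eqv n M (\<lambda>i j. if i \<in> K then M i j + (\<Sum>l\<in>S. X i l * M l j) else M i j)"
proof -
  \<comment> \<open>One source row is added to many targets; the sources are then treated one after
    the other.\<close>
  have single: "eqv n M (\<lambda>i j. if i \<in> K then M i j + Y i * M l j else M i j)"
    if "finite K" "K \<subseteq> {..<n}" "l < n" "l \<notin> K" "\<And>i. i \<in> K \<Longrightarrow> Y i \<in> R" for K l Y M
    using that
  proof (induction K rule: finite_induct)
    case empty
    show ?case by (rule eqv_cong) simp
  next
    case (insert k K)
    let ?M = "\<lambda>i j. if i \<in> K then M i j + Y i * M l j else M i j"
    have "eqv n M ?M" using insert by auto
    also have "eqv n ?M (\<lambda>i j. if i = k then ?M i j + Y k * ?M l j else ?M i j)"
      using insert by (intro eqv_add_row) auto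
    finally show ?case using insert by (elim eqv_cong_trans) auto
  qed
  have "finite S" using assms(1) finite_subset by blast
  then show ?thesis using assms
  proof (induction S rule: finite_induct)
    case empty
    show ?case by (rule eqv_cong) simp
  next
    case (insert l S)
    let ?M = "\<lambda>i j. if i \<in> K then M i j + (\<Sum>l\<in>S. X i l * M l j) else M i j"
    have "eqv n M ?M" using insert by auto
    also have "eqv n ?M (\<lambda>i j. if i \<in> K then ?M i j + X i l * ?M l j else ?M i j)"
      using insert finite_subset[of K "{..<n}"] by (intro single) auto
    finally show ?case using insert by (elim eqv_cong_trans) (auto simp: add_ac)
  qed
qed

lemma eqv_col_combination:
  assumes "S \<subseteq> {..<n}" "K \<subseteq> {..<n}" "K \<inter> S = {}" "\<And>j l. j \<in> K \<Longrightarrow> l \<in> S \<Longrightarrow> X l j \<in> R"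
  shows "eqv n M (\<lambda>i j. if j \<in> K then M i j + (\<Sum>l\<in>S. X l j * M i l) else M i j)"
proof -
  have single: "eqv n M (\<lambda>i j. if j \<in> K then M i j + Y j * M i l else M i j)"
    if "finite K" "K \<subseteq> {..<n}" "l < n" "l \<notin> K" "\<And>i. i \<in> K \<Longrightarrow> Y i \<in> R" for K l Y M
    using that
  proof (induction K rule: finite_induct)
    case empty
    show ?case by (rule eqv_cong) simp
  next
    case (insert k K)
    let ?M = "\<lambda>i j. if j \<in> K then M i j + Y j * M i l else M i j"
    have "eqv n M ?M" using insert by auto
    also have "eqv n ?M (\<lambda>i j. if j = k then ?M i j + Y k * ?M i l else ?M i j)"
      using insert by (intro eqv_add_col) auto
    finally show ?case using insert by (elim eqv_cong_trans) auto
  qed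
  have "finite S" using assms(1) finite_subset by blast
  then show ?thesis using assms
  proof (induction S rule: finite_induct)
    case empty
    show ?case by (rule eqv_cong) simp
  next
    case (insert l S)
    let ?M = "\<lambda>i j. if j \<in> K then M i j + (\<Sum>l\<in>S. X l j * M i l) else M i j"
    have "eqv n M ?M" using insert by auto
    also have "eqv n ?M (\<lambda>i j. if j \<in> K then ?M i j + X l j * ?M i l else ?M i j)"
      using insert finite_subset[of K "{..<n}"] by (intro single) auto
    finally show ?case using insert by (elim eqv_cong_trans) (auto simp: add_ac)
  qed
qed

section \<open>Diagonalizing the matrix with z above, 1 + z on and 1 below the diagonal\<close>

definition block :: "nat \<Rightarrow> nat set \<Rightarrow> (nat \<Rightarrow> nat \<Rightarrow> 'a) \<Rightarrow> bool" where
  "block n C M \<longleftrightarrow> (\<forall>i<n. \<forall>j<n. (i \<in> C) \<noteq> (j \<in> C) \<longrightarrow> M i j = 0)"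

text \<open>
  Splitting off the largest index reproduces the shape of the matrix with \<open>1 + z w\<close> in place of
  \<open>w\<close>; starting from \<open>w = 1\<close> this iteration produces the geometric sums.
\<close>

lemma eqv_step_block:
  fixes z w u :: 'a
  assumes "finite C" "C \<noteq> {}" "C \<subseteq> {..<n}" "z \<in> R" "w \<in> R" "u \<in> R"
    and "block n C M"
    and "\<And>i j. i \<in> C \<Longrightarrow> j \<in> C \<Longrightarrow> M i j =
      u * (if j = Max C then (if i = j then 1 + z * w else z * w)
           else if i < j then z else if i = j then 1 + z else 1)"
  shows "eqv n M (\<lambda>i j. if i \<in> C \<and> j \<in> C then
      (if i = j then u * (if i = Min C then ((\<lambda>w. 1 + z * w) ^^ card C) w else 1) else 0) else M i j)"
  using assms
proof (induction "card C" arbitrary: C M w)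
  case 0
  then show ?case by simp
next
  case (Suc k)
  show ?case
  proof (cases "k = 0")
    case True
    then obtain c where "C = {c}" using Suc.hyps(2) by (metis One_nat_def card_1_singletonE)
    with Suc.prems(8) show ?thesis by (intro eqv_cong) auto
  next
    case False
    define c where "c = Max C"
    define C' where "C' = C - {c}"
    define c' where "c' = Max C'"
    have cC: "c \<in> C" "\<And>i. i \<in> C \<Longrightarrow> i \<le> c" using Suc.prems by (auto simp: c_def)
    have C': "finite C'" "card C' = k" "C' \<subseteq> C" using Suc.prems Suc.hyps cC by (auto simp: C'_def)
    have ne: "C' \<noteq> {}" using False C' by auto
    have c': "c' \<in> C'" "\<And>i. i \<in> C' \<Longrightarrow> i \<le> c'" using ne C' by (auto simp: c'_def)
    have lt: "c' < c" "c \<noteq> c'" "c \<notin> C'" using c' cC by (force simp: C'_def)+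
    have n: "c < n" "c' < n" using c' cC C' Suc.prems(3) by auto
    have mx: "Max C = c" "Max C' = c'" by (auto simp: c_def c'_def)
    have CC': "i \<in> C \<longleftrightarrow> i = c \<or> i \<in> C'" for i using cC by (auto simp: C'_def)
    have ltc: "i < c" if "i \<in> C'" for i using that c' lt by fastforce
    have mn: "Min C = Min C'"
    proof (rule Min_eqI)
      show "finite C" "Min C' \<in> C" using Suc.prems C' ne by (auto simp: CC')
      show "Min C' \<le> y" if "y \<in> C" for y
        using that C' ne c' lt unfolding CC' by (metis Min_le order.trans less_imp_le)
    qed
    note val = Suc.prems(8)[unfolded mx]
    have zero: "M i j = 0" "M j i = 0" if "i \<in> C" "j \<notin> C" "j < n" for i j
      using that Suc.prems(3,7) unfolding block_def by auto
    \<comment> \<open>Up to \<open>u\<close>, rows \<open>c\<close> and \<open>c'\<close> agree left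
      of \<open>c'\<close>, so their difference is -z in column \<open>c'\<close> and 1 in column
      \<open>c\<close>. Adding z times column \<open>c\<close> to column \<open>c'\<close> clears
      the -z and turns the entries z there into z * (1 + z * w), which is the old pattern with 1 + z
      * w for \<open>w\<close>. The pivot in row \<open>c\<close> finally clears column
      \<open>c\<close>.\<close>
    let ?M1 = "\<lambda>i j. if i = c then M i j + (-1) * M c' j else M i j"
    let ?M2 = "\<lambda>i j. if j = c' then ?M1 i j + z * ?M1 i c else ?M1 i j"
    let ?M3 = "\<lambda>i j. if i \<in> C' then ?M2 i j + (\<Sum>l\<in>{c}. (- z * w) * ?M2 l j) else ?M2 i j"
    let ?N = "\<lambda>i j. if i \<in> C' \<and> j \<in> C' then
        u * (if j = c' then (if i = j then 1 + z * (1 + z * w) else z * (1 + z * w))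
           else if i < j then z else if i = j then 1 + z else 1)
        else if i \<in> C \<and> j \<in> C then (if i = j then u else 0) else M i j"
    have "eqv n M ?M1" using n lt uminus_in[OF one_in] by (intro eqv_add_row) auto
    also have "eqv n ?M1 ?M2" using n lt Suc.prems(4) by (intro eqv_add_col) auto
    also have "eqv n ?M2 ?M3"
      using n lt c' C' Suc.prems(3,4,5) by (intro eqv_row_combination) (auto intro: uminus_in mult_in)
    finally have 1: "eqv n M ?N"
    proof (rule eqv_cong_trans)
      fix i j assume ij: "i < n" "j < n"
      have c'C: "c' \<in> C" using c' C' by auto
      consider "i \<in> C'" "j \<in> C'" | "i = c" "j \<in> C'" | "i \<in> C'" "j = c" | "i = c" "j = c"
        | "i \<in> C" "j \<notin> C" | "i \<notin> C" "j \<in> C" | "i \<notin> C" "j \<notin> C"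
        unfolding CC' by blast
      then show "?M3 i j = ?N i j"
      proof cases
        case 1
        have "i \<in> C" "j \<in> C" "i \<noteq> c" "j \<noteq> c" "i < c" "j < c" "c' < c" using 1 lt ltc C' by auto
        moreover have "i \<le> c'" "j \<le> c'" using 1 c' by auto
        ultimately show ?thesis using 1 lt c'C cC
          by (auto simp: val algebra_simps)
      next
        case 2
        then show ?thesis using lt c'C cC c'(2)[of j] C' ltc[of j]
          by (auto simp: val algebra_simps)
      next
        case 3
        then show ?thesis using lt c'C cC c'(2)[of i] C' ltc[of i]
          by (auto simp: val algebra_simps)
      next
        case 4
        then show ?thesis using lt c'C cC by (auto simp: val algebra_simps)
      next
        case 5
        then show ?thesis using lt c'C cC ij C' by (auto simp: zero)
      next
        case 6
        then have "i \<notin> C'" "i \<noteq> c" unfolding CC' by auto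
        then show ?thesis using 6 lt c'C cC ij C' by (auto simp: zero)
      next
        case 7
        then have "i \<notin> C'" "i \<noteq> c" "j \<noteq> c'" "j \<notin> C'" unfolding CC' using c'C c'(1) by auto
        then show ?thesis using 7 by auto
      qed
    qed
    have "eqv n ?N (\<lambda>i j. if i \<in> C' \<and> j \<in> C' then
      (if i = j then u * (if i = Min C' then ((\<lambda>w. 1 + z * w) ^^ card C') (1 + z * w) else 1) else 0) else ?N i j)"
    proof (rule Suc.hyps(1))
      show "k = card C'" "finite C'" "C' \<noteq> {}" "z \<in> R" "u \<in> R" using C' ne Suc.prems by auto
      show "C' \<subseteq> {..<n}" using C' Suc.prems by auto
      show "1 + z * w \<in> R" using Suc.prems by (intro add_in mult_in one_in)
      show "block n C' ?N" unfolding block_def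
      proof (intro allI impI)
        fix i j assume ij: "i < n" "j < n" "(i \<in> C') \<noteq> (j \<in> C')"
        show "?N i j = 0"
        proof (cases "i \<in> C \<and> j \<in> C")
          case True then show ?thesis using ij by auto
        next
          case False
          then show ?thesis using ij zero[of i j] zero[of j i] C' by auto
        qed
      qed
    qed (auto simp: mx)
    with 1 have "eqv n M (\<lambda>i j. if i \<in> C' \<and> j \<in> C' then
      (if i = j then u * (if i = Min C' then ((\<lambda>w. 1 + z * w) ^^ card C') (1 + z * w) else 1) else 0) else ?N i j)"
      by (rule eqv_trans)
    then show ?thesis
    proof (rule eqv_cong_trans)
      fix i j assume ij: "i < n" "j < n"
      have 1: "((\<lambda>w. 1 + z * w) ^^ card C') (1 + z * w) = ((\<lambda>w. 1 + z * w) ^^ card C) w"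
        using C'(2) Suc.hyps(2)[symmetric] by (simp add: funpow_swap1[of "\<lambda>w. 1 + z * w"])
      have "Min C' \<in> C'" using C' ne by auto
      then have "Min C' \<noteq> c" using lt by auto
      then show "(if i \<in> C' \<and> j \<in> C' then
         (if i = j then u * (if i = Min C' then ((\<lambda>w. 1 + z * w) ^^ card C') (1 + z * w) else 1) else 0)
           else ?N i j) = (if i \<in> C \<and> j \<in> C then
         (if i = j then u * (if i = Min C then ((\<lambda>w. 1 + z * w) ^^ card C) w else 1) else 0) else M i j)"
        unfolding 1 mn CC' by auto
    qed
  qed
qed

text \<open>For \<open>w = 1\<close> the last column follows the same rule as the others. In the
  application \<open>card C\<close> is the degree of the glued piece minus 2, hence the range of
  exponents in the theorem.\<close>

lemma eqv_step_matrix: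
  fixes z u :: 'a
  assumes "C \<noteq> {}" "C \<subseteq> {..<n}" "z \<in> R" "u \<in> R"
    and "block n C M"
    and "\<And>i j. i \<in> C \<Longrightarrow> j \<in> C \<Longrightarrow> M i j = u * (if i < j then z else if i = j then 1 + z else 1)"
  shows "eqv n M (\<lambda>i j. if i \<in> C \<and> j \<in> C then
      (if i = j then u * (if i = Min C then (\<Sum>t=0..card C. z ^ t) else 1) else 0) else M i j)"
proof -
  have fin: "finite C" using assms(2) finite_subset by blast
  have "((\<lambda>w. 1 + z * w) ^^ k) 1 = (\<Sum>t=0..k. z ^ t)" for k
  proof (induction k)
    case (Suc k)
    have "(\<Sum>t=0..Suc k. z ^ t) = 1 + z * (\<Sum>t=0..k. z ^ t)"
      unfolding sum.atLeast0_atMost_Suc_shift by (simp add: sum_distrib_left)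
    with Suc show ?case by simp
  qed simp
  then have 1: "((\<lambda>w. 1 + z * w) ^^ card C) 1 = (\<Sum>t=0..card C. z ^ t)" .
  show ?thesis
    by (rule eqv_step_block[of C n z 1 u M, unfolded 1])
      (use assms fin one_in in \<open>auto dest: Max_ge\<close>)
qed

end

subsection \<open>Gluing a polygon onto an edge\<close>

text \<open>Walks without their end points, as functions on the set \<open>I\<close> of vertices passed.\<close>

definition fillings :: "nat set set \<Rightarrow> nat set \<Rightarrow> (nat \<Rightarrow> nat set) set" where
  "fillings D I = {p \<in> PiE I (\<lambda>k. {A \<in> D. k \<in> A}). \<forall>A\<in>D. card {k \<in> I. p k = A} \<le> card A - 2}"

definition fill_sum :: "(nat set \<Rightarrow> 'a) \<Rightarrow> nat set set \<Rightarrow> nat set \<Rightarrow> 'a::comm_ring_1" where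
  "fill_sum x D I = (\<Sum>p\<in>fillings D I. \<Prod>k\<in>I. x (p k))"

lemma finite_fillings: "finite D \<Longrightarrow> finite I \<Longrightarrow> finite (fillings D I)"
  unfolding fillings_def
  by (rule finite_subset[OF _ finite_PiE[of I "\<lambda>k. {A \<in> D. k \<in> A}"]]) auto

lemma fill_sum_empty [simp]: "fill_sum x D {} = 1"
  unfolding fill_sum_def fillings_def by simp

lemma fill_sum_uncovered: "k \<in> I \<Longrightarrow> k \<notin> \<Union>D \<Longrightarrow> fill_sum x D I = 0"
  unfolding fill_sum_def fillings_def by (auto simp: PiE_def Pi_def intro!: sum.neutral)

text \<open>Pigeonhole: the fibres of a filling over the pieces partition \<open>I\<close>, and each
  is bounded by the capacity of its piece.\<close>

lemma fill_sum_overfull: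
  assumes "finite D" "finite I" "card I > (\<Sum>A\<in>D. card A - 2)"
  shows "fill_sum x D I = 0"
proof -
  have "fillings D I = {}"
  proof (rule ccontr)
    assume "fillings D I \<noteq> {}"
    then obtain p where p: "p \<in> PiE I (\<lambda>k. {A \<in> D. k \<in> A})" "\<forall>A\<in>D. card {k \<in> I. p k = A} \<le> card A - 2"
      unfolding fillings_def by auto
    have "I = (\<Union>A\<in>D. {k \<in> I. p k = A})" using p(1) by (auto simp: PiE_def Pi_def)
    then have "card I \<le> (\<Sum>A\<in>D. card {k \<in> I. p k = A})" using card_UN_le[OF assms(1)] by metis
    also have "\<dots> \<le> (\<Sum>A\<in>D. card A - 2)" using p(2) by (intro sum_mono) auto
    finally show False using assms(3) by simp
  qed
  then show ?thesis by (simp add: fill_sum_def)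
qed

text \<open>Fillings are sorted by the set \<open>T\<close> of vertices assigned to the new piece;
  off \<open>T\<close> they are fillings by the old pieces. As \<open>B\<close> is not old,
  \<open>T\<close> can be recovered as the fibre over \<open>B\<close>.\<close>

lemma fill_sum_insert:
  assumes "finite D" "finite I" "B \<notin> D"
  shows "fill_sum x (insert B D) I =
    (\<Sum>T\<in>{T. T \<subseteq> I \<inter> B \<and> card T \<le> card B - 2}. x B ^ card T * fill_sum x D (I - T))"
proof -
  define \<T> where "\<T> = {T. T \<subseteq> I \<inter> B \<and> card T \<le> card B - 2}"
  have fin: "finite \<T>" by (rule finite_subset[of _ "Pow I"]) (use assms in \<open>auto simp: \<T>_def\<close>)
  have "(\<Sum>T\<in>\<T>. x B ^ card T * fill_sum x D (I - T)) =
    (\<Sum>(T, p)\<in>(SIGMA T:\<T>. fillings D (I - T)). x B ^ card T * (\<Prod>k\<in>I - T. x (p k)))"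
    unfolding fill_sum_def using fin assms
    by (subst sum.Sigma[symmetric]) (auto simp: sum_distrib_left finite_fillings)
  also have "\<dots> = (\<Sum>p\<in>fillings (insert B D) I. \<Prod>k\<in>I. x (p k))"
  proof (rule sum.reindex_bij_witness[of _ "\<lambda>p. ({k\<in>I. p k = B}, restrict p (I - {k\<in>I. p k = B}))"
      "\<lambda>(T, p). (\<lambda>k. if k \<in> T then B else p k)"], goal_cases)
    case (1 Tp)
    obtain T p where Tp: "Tp = (T, p)" by (cases Tp)
    with 1 have T: "T \<subseteq> I" "T \<subseteq> B" and p: "p \<in> PiE (I - T) (\<lambda>k. {A \<in> D. k \<in> A})"
      by (auto simp: \<T>_def fillings_def)
    have "{k \<in> I. (if k \<in> T then B else p k) = B} = T"
      using T p assms(3) by (auto simp: PiE_def Pi_def split: if_splits)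
    moreover have "restrict (\<lambda>k. if k \<in> T then B else p k) (I - T) = p"
      using p by (intro ext) (auto simp: restrict_def PiE_def extensional_def)
    ultimately show ?case by (simp add: Tp)
  next
    case (2 Tp)
    obtain T p where Tp: "Tp = (T, p)" by (cases Tp)
    with 2 have T: "T \<subseteq> I" "T \<subseteq> B" "card T \<le> card B - 2" and p: "p \<in> PiE (I - T) (\<lambda>k. {A \<in> D. k \<in> A})"
      "\<forall>A\<in>D. card {k \<in> I - T. p k = A} \<le> card A - 2"
      by (auto simp: \<T>_def fillings_def)
    let ?f = "\<lambda>k. if k \<in> T then B else p k"
    have "{k \<in> I. ?f k = B} = T"
      using T p assms(3) by (auto simp: PiE_def Pi_def split: if_splits)
    moreover have "{k \<in> I. ?f k = A} = {k \<in> I - T. p k = A}" if "A \<in> D" for A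
      using that assms(3) by (auto split: if_splits)
    moreover have "?f \<in> PiE I (\<lambda>k. {A \<in> insert B D. k \<in> A})"
      using T p(1) by (auto simp: PiE_def Pi_def extensional_def)
    ultimately show ?case using T p by (auto simp: Tp fillings_def)
  next
    case (3 p)
    then show ?case by (auto simp: fillings_def PiE_def extensional_def restrict_def fun_eq_iff)
  next
    case (4 p)
    let ?T = "{k\<in>I. p k = B}"
    have "?T \<subseteq> B" using 4 by (auto simp: fillings_def PiE_def Pi_def)
    moreover have "{k \<in> I - ?T. restrict p (I - ?T) k = A} = {k \<in> I. p k = A}" if "A \<in> D" for A
      using that assms(3) by auto
    ultimately show ?case using 4 by (auto simp: \<T>_def fillings_def PiE_def Pi_def)
  next
    case (5 Tp)
    obtain T p where Tp: "Tp = (T, p)" by (cases Tp)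
    with 5 have T: "T \<subseteq> I" by (auto simp: \<T>_def)
    have "(\<Prod>k\<in>I. x (if k \<in> T then B else p k)) =
      (\<Prod>k\<in>T. x (if k \<in> T then B else p k)) * (\<Prod>k\<in>I - T. x (if k \<in> T then B else p k))"
      using T assms by (metis (no_types, lifting) mult.commute prod.subset_diff)
    also have "(\<Prod>k\<in>I - T. x (if k \<in> T then B else p k)) = (\<Prod>k\<in>I - T. x (p k))"
      by (rule prod.cong) auto
    finally show ?case by (simp add: Tp)
  qed
  finally show ?thesis by (simp add: fill_sum_def \<T>_def)
qed

text \<open>
  A pair of a vertex set and the set of pieces of a dissection. Starting from the digon, whose
  dissection has no piece at all, makes the undissected polygon a case of gluing.
\<close>

inductive glued :: "nat set \<Rightarrow> nat set set \<Rightarrow> bool" where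
  digon: "a < b \<Longrightarrow> glued {a, b} {}"
| glue: "glued V D \<Longrightarrow> a \<in> V \<Longrightarrow> b \<in> V \<Longrightarrow> a < b \<Longrightarrow> V \<inter> {a<..<b} = {} \<Longrightarrow>
    B \<subseteq> {a..b} \<Longrightarrow> a \<in> B \<Longrightarrow> b \<in> B \<Longrightarrow> 3 \<le> card B \<Longrightarrow> glued (V \<union> B) (insert B D)"

text \<open>
  For \<open>i = j\<close> this is \<open>V - {i}\<close>: the diagonal entries of the weight matrix need no special
  treatment, since a filling of \<open>V - {i}\<close> would exceed the total capacity of the pieces.
\<close>

definition between :: "nat set \<Rightarrow> nat \<Rightarrow> nat \<Rightarrow> nat set" where
  "between V i j = {k \<in> V. if i < j then i < k \<and> k < j else i < k \<or> k < j}"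

text \<open>Only the counting facts about the old dissection are kept, not its history.
  \<open>capacity\<close> is the decisive one: the old pieces cannot fill all of \<open>V\<close>
  but one vertex, and a filling of all but two must use each piece to its limit.\<close>

locale gluing =
  fixes V :: "nat set" and D :: "nat set set" and a b :: nat and B :: "nat set"
    and x :: "nat set \<Rightarrow> 'a::comm_ring_1"
  assumes finV: "finite V" and finD: "finite D" and D_sub: "\<Union>D \<subseteq> V"
    and capacity: "(\<Sum>A\<in>D. card A - 2) + 2 = card V"
    and ab: "a \<in> V" "b \<in> V" "a < b" and consecutive: "V \<inter> {a<..<b} = {}"
    and B: "B \<subseteq> {a..b}" "a \<in> B" "b \<in> B" "3 \<le> card B"
begin

text \<open>\<open>C\<close> holds the new vertices. Its size \<open>r\<close> is at the same time
  the capacity of \<open>B\<close>, a coincidence on which the entry formulas depend.\<close>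

definition "C = B - {a, b}"
definition "r = card C"

lemma C_facts: "finite C" "C \<subseteq> {a<..<b}" "V \<inter> C = {}" "B = C \<union> {a, b}" "card B = r + 2" "0 < r"
  "V \<union> B = V \<union> C"
proof -
  have "finite B" using B finite_subset by blast
  then show "finite C" by (simp add: C_def)
  show *: "C \<subseteq> {a<..<b}" using B(1) by (force simp: C_def)
  then show "V \<inter> C = {}" using consecutive by blast
  show "B = C \<union> {a, b}" "V \<union> B = V \<union> C" using B ab by (auto simp: C_def)
  have "card C = card B - card {a, b}"
    unfolding C_def using B by (intro card_Diff_subset) auto
  then show "card B = r + 2" "0 < r" using ab B by (auto simp: r_def)
qed

lemma B_notin_D: "B \<notin> D"
proof
  assume "B \<in> D"
  then have "C = {}" using D_sub C_facts(3,4) by blast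
  then show False using C_facts(6) by (simp add: r_def)
qed

abbreviation "F \<equiv> fill_sum x (insert B D)"
abbreviation "F' \<equiv> fill_sum x D"

lemma F'_overfull: "I \<subseteq> V \<Longrightarrow> card V < card I + 2 \<Longrightarrow> F' I = 0"
  using capacity finV finD finite_subset[of I V] by (intro fill_sum_overfull) auto

text \<open>Vertices of \<open>C\<close> lie in no old piece, so all of those in \<open>I\<close>
  must go to \<open>B\<close>. The only freedom left is which of the end points of the diagonal go
  to \<open>B\<close> as well.\<close>

lemma F_split:
  assumes "I \<subseteq> V \<union> C"
  shows "F I = (\<Sum>T\<in>{T. T \<subseteq> I \<inter> {a, b} \<and> card (I \<inter> C) + card T \<le> r}.
     x B ^ (card (I \<inter> C) + card T) * F' (I \<inter> V - T))"
proof -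
  have finI: "finite I" using assms finV C_facts finite_subset by blast
  define \<S> where "\<S> = {T. T \<subseteq> I \<inter> {a, b} \<and> card (I \<inter> C) + card T \<le> r}"
  define \<T> where "\<T> = {T. T \<subseteq> I \<inter> B \<and> card T \<le> r}"
  have fin: "finite \<T>" by (rule finite_subset[of _ "Pow I"]) (use finI in \<open>auto simp: \<T>_def\<close>)
  have abC: "{a, b} \<inter> C = {}" using C_facts(2) by auto
  have card: "card ((I \<inter> C) \<union> T) = card (I \<inter> C) + card T" if "T \<subseteq> {a, b}" for T
    using that C_facts(1) abC by (intro card_Un_disjoint) (blast intro: finite_subset)+
  have inj: "inj_on (\<lambda>T. (I \<inter> C) \<union> T) \<S>"
    using abC by (intro inj_on_inverseI[where g = "\<lambda>X. X \<inter> {a, b}"]) (auto simp: \<S>_def)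
  have sub: "(\<lambda>T. (I \<inter> C) \<union> T) ` \<S> \<subseteq> \<T>"
    using card C_facts(4) by (auto simp: \<S>_def \<T>_def)
  have "F I = (\<Sum>T\<in>\<T>. x B ^ card T * F' (I - T))"
    using fill_sum_insert[OF finD finI B_notin_D, of x] C_facts(5) by (simp add: \<T>_def)
  also have "\<dots> = (\<Sum>T\<in>(\<lambda>T. (I \<inter> C) \<union> T) ` \<S>. x B ^ card T * F' (I - T))"
  proof (rule sum.mono_neutral_right[OF fin sub], rule ballI)
    fix T assume T: "T \<in> \<T> - (\<lambda>T. (I \<inter> C) \<union> T) ` \<S>"
    have "\<not> I \<inter> C \<subseteq> T"
    proof
      assume "I \<inter> C \<subseteq> T"
      then have eq: "T = (I \<inter> C) \<union> (T \<inter> {a, b})" using T C_facts(4) by (auto simp: \<T>_def)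
      then have "card T = card (I \<inter> C) + card (T \<inter> {a, b})" using card[of "T \<inter> {a, b}"] by simp
      then have "T \<inter> {a, b} \<in> \<S>" using T by (auto simp: \<T>_def \<S>_def)
      with eq T show False by blast
    qed
    then obtain k where "k \<in> I - T" "k \<in> C" by auto
    moreover then have "k \<notin> \<Union>D" using D_sub C_facts by auto
    ultimately show "x B ^ card T * F' (I - T) = 0" using fill_sum_uncovered by (metis mult_zero_right)
  qed
  also have "\<dots> = (\<Sum>T\<in>\<S>. x B ^ card ((I \<inter> C) \<union> T) * F' (I - ((I \<inter> C) \<union> T)))"
    by (subst sum.reindex[OF inj]) simp
  also have "\<dots> = (\<Sum>T\<in>\<S>. x B ^ (card (I \<inter> C) + card T) * F' (I \<inter> V - T))"
  proof (rule sum.cong[OF refl])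
    fix T assume T: "T \<in> \<S>"
    then have "I - ((I \<inter> C) \<union> T) = I \<inter> V - T" using assms C_facts(3) by blast
    with T card[of T] show "x B ^ card ((I \<inter> C) \<union> T) * F' (I - ((I \<inter> C) \<union> T)) =
      x B ^ (card (I \<inter> C) + card T) * F' (I \<inter> V - T)" by (auto simp: \<S>_def)
  qed
  finally show ?thesis by (simp add: \<S>_def)
qed

text \<open>The new vertices alone exhaust \<open>B\<close>, so nothing is left for \<open>a\<close>
  and \<open>b\<close>.\<close>

lemma F_full:
  assumes "I \<subseteq> V \<union> C" "C \<subseteq> I"
  shows "F I = x B ^ r * F' (I \<inter> V)"
proof -
  have "I \<inter> C = C" using assms by auto
  then have "{T. T \<subseteq> I \<inter> {a, b} \<and> card (I \<inter> C) + card T \<le> r} = {{}}"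
    by (auto simp: r_def card_eq_0_iff intro: finite_subset)
  then show ?thesis using F_split[OF assms(1)] \<open>I \<inter> C = C\<close> by (simp add: r_def)
qed

lemma card_part: "card (I \<inter> C) \<le> r"
  unfolding r_def using C_facts by (intro card_mono) auto

lemma card_part_less: "\<not> C \<subseteq> I \<Longrightarrow> card (I \<inter> C) < r"
  unfolding r_def using C_facts by (intro psubset_card_mono) auto

lemma F_off:
  assumes "I \<subseteq> V \<union> C" "a \<notin> I" "b \<notin> I"
  shows "F I = x B ^ card (I \<inter> C) * F' (I \<inter> V)"
proof -
  have "{T. T \<subseteq> I \<inter> {a, b} \<and> card (I \<inter> C) + card T \<le> r} = {{}}"
    using assms card_part by auto
  then show ?thesis using F_split[OF assms(1)] by simp
qed

text \<open>Some vertex of \<open>C\<close> is not passed, so \<open>B\<close> still has room for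
  the end point \<open>e\<close>: one term for each decision about it.\<close>

lemma F_one:
  assumes "I \<subseteq> V \<union> C" "I \<inter> {a, b} = {e}" "\<not> C \<subseteq> I"
  shows "F I = x B ^ card (I \<inter> C) * F' (I \<inter> V) + x B ^ (card (I \<inter> C) + 1) * F' (I \<inter> V - {e})"
proof -
  have "{T. T \<subseteq> I \<inter> {a, b} \<and> card (I \<inter> C) + card T \<le> r} = {{}, {e}}"
    using assms(2) card_part_less[OF assms(3)] by auto
  then show ?thesis using F_split[OF assms(1)] by simp
qed

text \<open>The old pieces can serve at most all but two vertices of \<open>V\<close>, so both
  \<open>a\<close> and \<open>b\<close> are forced onto \<open>B\<close>.\<close>

lemma F_all:
  assumes "V \<subseteq> I" "I \<subseteq> V \<union> C" "card (I \<inter> C) + 2 \<le> r"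
  shows "F I = x B ^ (card (I \<inter> C) + 2) * F' (V - {a, b})"
proof -
  define \<S> where "\<S> = {T. T \<subseteq> {a, b} \<and> card (I \<inter> C) + card T \<le> r}"
  have IV: "I \<inter> V = V" "I \<inter> {a, b} = {a, b}" using assms ab by auto
  have c2: "card {a, b} = 2" using ab by simp
  have S: "{a, b} \<in> \<S>" "finite \<S>" using assms c2 by (auto simp: \<S>_def)
  have "F I = (\<Sum>T\<in>\<S>. x B ^ (card (I \<inter> C) + card T) * F' (V - T))"
    using F_split[OF assms(2)] unfolding IV \<S>_def .
  also have "\<dots> = (\<Sum>T\<in>{{a, b}}. x B ^ (card (I \<inter> C) + card T) * F' (V - T))"
  proof (rule sum.mono_neutral_right[OF S(2)], use S in simp, rule ballI)
    \<comment> \<open>A proper subset of \<open>{a, b}\<close> leaves more vertices of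
      \<open>V\<close> than the old pieces can take.\<close>
    fix T assume T: "T \<in> \<S> - {{a, b}}"
    then have fT: "finite T" "T \<subseteq> V" "T \<subset> {a, b}" using ab by (auto simp: \<S>_def intro: finite_subset)
    then have "card T < 2" using psubset_card_mono[of "{a, b}" T] c2 by auto
    moreover have "card (V - T) = card V - card T" "card T \<le> card V"
      using fT finV by (auto simp: card_Diff_subset card_mono)
    ultimately have "F' (V - T) = 0" by (intro F'_overfull) auto
    then show "x B ^ (card (I \<inter> C) + card T) * F' (V - T) = 0" by simp
  qed
  finally show ?thesis using c2 by simp
qed

end

text \<open>
  The weight matrix after conjugation with the diagonal matrix of the partial products
  \<open>q\<^sub>0 \<cdots> q\<^bsub>i-1\<^esub>\<close>, which leaves only the total weight \<open>e\<close> of all edges below the diagonal.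
\<close>

definition entry :: "(nat set \<Rightarrow> 'a) \<Rightarrow> nat set set \<Rightarrow> nat set \<Rightarrow> 'a \<Rightarrow> nat \<Rightarrow> nat \<Rightarrow> 'a::comm_ring_1" where
  "entry x D V e i j = (if i < j then 1 else e) * fill_sum x D (between V i j)"

text \<open>The digon has two vertices and no capacity; each gluing adds equally many vertices and
  units of capacity.\<close>

lemma glued_facts:
  assumes "glued V D"
  shows "finite V \<and> finite D \<and> \<Union>D \<subseteq> V \<and> (\<Sum>A\<in>D. card A - 2) + 2 = card V \<and> (\<forall>A\<in>D. 3 \<le> card A)"
  using assms
proof induction
  case (digon a b)
  then show ?case by simp
next
  case (glue V D a b B)
  then interpret gluing V D a b B "\<lambda>_. 0 :: int"
    by unfold_locales auto
  have "card (V \<union> B) = card V + r"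
    using C_facts glue.IH by (simp add: card_Un_disjoint r_def)
  then show ?case using glue C_facts B_notin_D by auto
qed

lemma gluing_glued:
  assumes "glued V D" "a \<in> V" "b \<in> V" "a < b" "V \<inter> {a<..<b} = {}" "B \<subseteq> {a..b}" "a \<in> B" "b \<in> B"
    "3 \<le> card B"
  shows "gluing V D a b B"
  using assms glued_facts[OF assms(1)] by unfold_locales auto

section \<open>Entries of the matrix of the glued polygon\<close>

context gluing
begin

text \<open>The exponents forced by \<open>C\<close>: a walk from an old vertex to \<open>j\<close>
  in \<open>C\<close> passes \<open>p j\<close> new vertices, a walk from \<open>j\<close> to an old
  vertex passes \<open>s j\<close>.\<close>

definition "p j = card (C \<inter> {..<j})"
definition "s j = card (C \<inter> {j<..})"

abbreviation "U \<equiv> V \<union> B"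
abbreviation "y \<equiv> x B"

lemma U_eq: "U = V \<union> C" by (rule C_facts(7))

lemma C_iff: "k \<in> C \<Longrightarrow> a < k \<and> k < b"
  using C_facts(2) by auto

lemma V_iff: "k \<in> V \<Longrightarrow> k \<le> a \<or> b \<le> k"
  using consecutive by force

lemma p_s: "j \<in> C \<Longrightarrow> p j + s j + 1 = r"
proof -
  assume j: "j \<in> C"
  have "C = (C \<inter> {..<j}) \<union> (C \<inter> {j<..}) \<union> {j}" using j by auto
  then have "card C = card ((C \<inter> {..<j}) \<union> (C \<inter> {j<..}) \<union> {j})" by metis
  also have "\<dots> = p j + s j + 1" unfolding p_def s_def
    using C_facts(1) by (subst card_Un_disjoint, auto)+
  finally show ?thesis by (simp add: r_def)
qed

lemma between_V: "between U i j \<inter> V = between V i j"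
  by (auto simp: between_def)

lemma between_sub: "between U i j \<subseteq> V \<union> C" "between V i j \<subseteq> V"
  using U_eq by (auto simp: between_def)

lemma F'_between_same: "i \<in> V \<Longrightarrow> F' (V - {i}) = 0"
proof (rule F'_overfull)
  assume "i \<in> V"
  then show "card V < card (V - {i}) + 2" using finV by simp
qed auto

lemma between_same: "between W i i = W - {i}"
  by (auto simp: between_def)

lemma entry_same:
  assumes "i \<in> U"
  shows "entry x (insert B D) U e i i = 0"
proof -
  have "finite U" using U_eq finV C_facts by auto
  moreover have "card U = card V + r"
    using C_facts finV by (simp add: card_Un_disjoint r_def)
  moreover have "(\<Sum>A\<in>insert B D. card A - 2) + 2 = card V + r"
    using capacity finD B_notin_D C_facts(5) by simp
  ultimately have "F (U - {i}) = 0"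
    using assms finD by (intro fill_sum_overfull) auto
  then show ?thesis by (simp add: entry_def between_same)
qed

text \<open>A walk between old vertices gains \<open>y ^ r\<close> exactly when it passes all of
  \<open>C\<close>, that is, when it traverses the edge from \<open>a\<close> to \<open>b\<close> of
  the smaller polygon. So \<open>y ^ r\<close> acts as the weight of that edge, and rescaling the
  vertices from \<open>b\<close> onwards moves it into the total edge weight. Stated without
  inverses.\<close>

lemma entry_outer:
  assumes "i \<in> V" "j \<in> V"
  shows "(if b \<le> i then y ^ r else 1) * entry x (insert B D) U e i j =
    entry x D V (e * y ^ r) i j * (if b \<le> j then y ^ r else 1)"
proof -
  note V = V_iff[OF assms(1)] V_iff[OF assms(2)]
  consider "i \<le> a" "i < j" "b \<le> j" | "i < j" "j \<le> a" | "b \<le> i" "i < j" | "j \<le> i" "i \<le> a"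
    | "b \<le> j" "j \<le> i" | "j \<le> a" "b \<le> i" using V ab(3) by linarith
  then show ?thesis
  proof cases
    case 1
    then have "C \<subseteq> between U i j" using C_iff U_eq by (fastforce simp: between_def)
    then show ?thesis using F_full[OF between_sub(1)] 1 ab(3) between_V by (simp add: entry_def)
  next
    case 2
    then have "a \<notin> between U i j" "b \<notin> between U i j" "between U i j \<inter> C = {}"
      using ab by (auto simp: between_def dest!: C_iff)
    then show ?thesis using F_off[OF between_sub(1)] 2 ab(3) between_V by (simp add: entry_def)
  next
    case 3
    then have "a \<notin> between U i j" "b \<notin> between U i j" "between U i j \<inter> C = {}"
      using ab by (auto simp: between_def dest!: C_iff)
    then show ?thesis using F_off[OF between_sub(1)] 3 ab(3) between_V by (simp add: entry_def)
  next
    case 4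
    then have "C \<subseteq> between U i j" using C_iff U_eq by (fastforce simp: between_def)
    then show ?thesis using F_full[OF between_sub(1)] 4 ab(3) between_V by (simp add: entry_def)
  next
    case 5
    then have "C \<subseteq> between U i j" using C_iff U_eq by (fastforce simp: between_def)
    then show ?thesis using F_full[OF between_sub(1)] 5 ab(3) between_V by (simp add: entry_def)
  next
    case 6
    then have "a \<notin> between U i j" "b \<notin> between U i j" "between U i j \<inter> C = {}"
      using ab by (auto simp: between_def dest!: C_iff)
    then show ?thesis using F_off[OF between_sub(1)] 6 ab(3) between_V by (simp add: entry_def)
  qed
qed

lemma between_b_a: "between V b a = V - {a, b}"
  unfolding set_eq_iff
proof
  fix k
  show "k \<in> between V b a \<longleftrightarrow> k \<in> V - {a, b}" using ab V_iff[of k] by (auto simp: between_def)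
qed

lemma between_into_C:
  assumes "i \<in> V" "j \<in> C"
  shows "i \<noteq> b \<Longrightarrow> between V i b = between U i j \<inter> V"
    "i \<noteq> a \<Longrightarrow> between V i a = between U i j \<inter> V - {a}"
    "i \<noteq> a \<Longrightarrow> a \<in> between U i j" "b \<notin> between U i j"
    "between U i j \<inter> C = C \<inter> {..<j}" "j \<notin> between U i j"
proof -
  note f = V_iff[OF assms(1)] C_iff[OF assms(2)] ab(3)
  have V: "k \<in> V \<Longrightarrow> (if i < j then i < k \<and> k < j else i < k \<or> k < j) \<longleftrightarrow>
      (if i < b then i < k \<and> k < b else i < k \<or> k < b)" if "i \<noteq> b" for k
    using V_iff[of k] f that by (auto split: if_splits)
  show "between V i b = between U i j \<inter> V" if "i \<noteq> b"
    using V[OF that] unfolding between_def by blast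
  have V: "k \<in> V \<Longrightarrow> k \<noteq> a \<and> (if i < j then i < k \<and> k < j else i < k \<or> k < j) \<longleftrightarrow>
      (if i < a then i < k \<and> k < a else i < k \<or> k < a)" if "i \<noteq> a" for k
    using V_iff[of k] f that by (auto split: if_splits)
  show "between V i a = between U i j \<inter> V - {a}" if "i \<noteq> a"
    using V[OF that] unfolding between_def by blast
  show "a \<in> between U i j" if "i \<noteq> a"
    using that f ab(1) by (auto simp: between_def split: if_splits)
  show "b \<notin> between U i j" "j \<notin> between U i j"
    using f by (auto simp: between_def split: if_splits)
  have C: "k \<in> C \<Longrightarrow> (if i < j then i < k \<and> k < j else i < k \<or> k < j) \<longleftrightarrow> k < j" for k
    using C_iff[of k] f by (auto split: if_splits)
  show "between U i j \<inter> C = C \<inter> {..<j}"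
    using C unfolding between_def U_eq by blast
qed

lemma between_from_C:
  assumes "i \<in> C" "j \<in> V"
  shows "j \<noteq> a \<Longrightarrow> between V a j = between U i j \<inter> V"
    "j \<noteq> b \<Longrightarrow> between V b j = between U i j \<inter> V - {b}"
    "j \<noteq> b \<Longrightarrow> b \<in> between U i j" "a \<notin> between U i j"
    "between U i j \<inter> C = C \<inter> {i<..}" "i \<notin> between U i j"
proof -
  note f = V_iff[OF assms(2)] C_iff[OF assms(1)] ab(3)
  have V: "k \<in> V \<Longrightarrow> (if i < j then i < k \<and> k < j else i < k \<or> k < j) \<longleftrightarrow>
      (if a < j then a < k \<and> k < j else a < k \<or> k < j)" if "j \<noteq> a" for k
    using V_iff[of k] f that by (auto split: if_splits)
  show "between V a j = between U i j \<inter> V" if "j \<noteq> a"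
    using V[OF that] unfolding between_def by blast
  have V: "k \<in> V \<Longrightarrow> k \<noteq> b \<and> (if i < j then i < k \<and> k < j else i < k \<or> k < j) \<longleftrightarrow>
      (if b < j then b < k \<and> k < j else b < k \<or> k < j)" if "j \<noteq> b" for k
    using V_iff[of k] f that by (auto split: if_splits)
  show "between V b j = between U i j \<inter> V - {b}" if "j \<noteq> b"
    using V[OF that] unfolding between_def by blast
  show "b \<in> between U i j" if "j \<noteq> b"
    using that f ab(2) by (auto simp: between_def split: if_splits)
  show "a \<notin> between U i j" "i \<notin> between U i j"
    using f by (auto simp: between_def split: if_splits)
  have C: "k \<in> C \<Longrightarrow> (if i < j then i < k \<and> k < j else i < k \<or> k < j) \<longleftrightarrow> i < k" for k
    using C_iff[of k] f by (auto split: if_splits)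
  show "between U i j \<inter> C = C \<inter> {i<..}"
    using C unfolding between_def U_eq by blast
qed


abbreviation "E e \<equiv> entry x (insert B D) U e"
abbreviation "G \<equiv> F' (V - {a, b})"

lemma entry_to_a:
  assumes "i \<in> V"
  shows "E e i a = (if i = a then 0 else (if i < a then 1 else e) * F' (between V i a))"
proof (cases "i = a")
  case True
  then show ?thesis using entry_same[of a e] ab by simp
next
  case False
  have i: "i < a \<or> b \<le> i" using V_iff[OF assms] False by auto
  have "k \<in> C \<Longrightarrow> k \<notin> between U i a" for k
    using C_iff[of k] i ab(3) by (auto simp: between_def)
  then have "between U i a \<inter> C = {}" by blast
  moreover have "a \<notin> between U i a" "b \<notin> between U i a"
    using V_iff[OF assms] ab False by (auto simp: between_def split: if_splits)
  ultimately show ?thesis using F_off[OF between_sub(1)] False between_V by (simp add: entry_def)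
qed

lemma entry_from_b:
  assumes "j \<in> V"
  shows "E e b j = (if j = b then 0 else (if b < j then 1 else e) * F' (between V b j))"
proof (cases "j = b")
  case True
  then show ?thesis using entry_same[of b e] ab by simp
next
  case False
  have j: "b < j \<or> j \<le> a" using V_iff[OF assms] False by auto
  have "k \<in> C \<Longrightarrow> k \<notin> between U b j" for k
    using C_iff[of k] j ab(3) by (auto simp: between_def)
  then have "between U b j \<inter> C = {}" by blast
  moreover have "a \<notin> between U b j" "b \<notin> between U b j"
    using j ab by (auto simp: between_def split: if_splits)
  ultimately show ?thesis using F_off[OF between_sub(1)] False between_V by (simp add: entry_def)
qed

lemma entry_to_b:
  assumes "i \<in> V"
  shows "E e i b = (if i = b then 0 else (if i < b then 1 else e) * (y ^ r * F' (between V i b)))"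
proof (cases "i = b")
  case True
  then show ?thesis using entry_same[of b e] ab by simp
next
  case False
  have i: "i \<le> a \<or> b < i" using V_iff[OF assms] False by auto
  have "k \<in> C \<Longrightarrow> k \<in> between U i b" for k
    using C_iff[of k] i ab(3) U_eq by (auto simp: between_def)
  then have "C \<subseteq> between U i b" by blast
  then show ?thesis using F_full[OF between_sub(1)] False between_V by (simp add: entry_def)
qed

lemma entry_from_a:
  assumes "j \<in> V"
  shows "E e a j = (if j = a then 0 else (if a < j then 1 else e) * (y ^ r * F' (between V a j)))"
proof (cases "j = a")
  case True
  then show ?thesis using entry_same[of a e] ab by simp
next
  case False
  have j: "j < a \<or> b \<le> j" using V_iff[OF assms] False by auto
  have "k \<in> C \<Longrightarrow> k \<in> between U a j" for k
    using C_iff[of k] j ab(3) U_eq by (auto simp: between_def)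
  then have "C \<subseteq> between U a j" by blast
  then show ?thesis using F_full[OF between_sub(1)] False between_V by (simp add: entry_def)
qed

lemma between_a_b: "between V a b = {}"
  using consecutive ab(3) by (auto simp: between_def)

lemma entry_a_b: "E e a b = y ^ r"
  using entry_to_b[OF ab(1)] ab(3) between_a_b by simp

lemma entry_b_a: "E e b a = e * G"
  using entry_to_a[OF ab(2)] ab(3) between_b_a by simp

lemma entry_a_C:
  assumes "j \<in> C"
  shows "E e a j = y ^ p j"
proof -
  have "k \<in> V \<Longrightarrow> \<not> (a < k \<and> k < j)" for k
    using V_iff[of k] C_iff[OF assms] by auto
  then have "between U a j \<inter> V = {}" using C_iff[OF assms] by (auto simp: between_def)
  moreover from this have "a \<notin> between U a j" using ab by auto
  ultimately show ?thesis
    using F_off[OF between_sub(1), of a j] between_into_C(4,5)[OF ab(1) assms] C_iff[OF assms]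
    by (simp add: entry_def p_def)
qed

lemma entry_C_b:
  assumes "i \<in> C"
  shows "E e i b = y ^ s i"
proof -
  have "k \<in> V \<Longrightarrow> \<not> (i < k \<and> k < b)" for k
    using V_iff[of k] C_iff[OF assms] by auto
  then have "between U i b \<inter> V = {}" using C_iff[OF assms] by (auto simp: between_def)
  moreover from this have "b \<notin> between U i b" using ab by auto
  ultimately show ?thesis
    using F_off[OF between_sub(1), of i b] between_from_C(4,5)[OF assms ab(2)] C_iff[OF assms]
    by (simp add: entry_def s_def)
qed

text \<open>Such a walk passes \<open>a\<close> but not \<open>b\<close>. The two terms correspond
  to serving \<open>a\<close> by an old piece or by \<open>B\<close>.\<close>

lemma entry_V_C:
  assumes "i \<in> V" "i \<noteq> a" "j \<in> C"
  shows "E e i j = (if i < a then 1 else e) *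
    (y ^ p j * (if i = b then 0 else F' (between V i b)) + y ^ (p j + 1) * F' (between V i a))"
proof -
  note btw = between_into_C[OF assms(1,3)]
  have "F (between U i j) = y ^ p j * F' (between U i j \<inter> V) + y ^ (p j + 1) * F' (between V i a)"
    using F_one[OF between_sub(1), of i j a] btw assms ab by (auto simp: p_def)
  moreover have "F' (between U i j \<inter> V) = (if i = b then 0 else F' (between V i b))"
  proof (cases "i = b")
    \<comment> \<open>From \<open>b\<close>, the old vertices passed are all of \<open>V\<close>
      except \<open>b\<close>, one too many for the old pieces; only the term with \<open>a\<close>
      on \<open>B\<close> survives.\<close>
    case True
    have "k \<in> V \<Longrightarrow> (if b < j then b < k \<and> k < j else b < k \<or> k < j) \<longleftrightarrow> k \<noteq> b" for k
      using V_iff[of k] C_iff[OF assms(3)] ab(3) by (auto split: if_splits)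
    then have "between U b j \<inter> V = V - {b}" unfolding between_def by blast
    then show ?thesis using True F'_between_same[OF ab(2)] by simp
  qed (use btw in simp)
  moreover have "i < j \<longleftrightarrow> i < a"
    using V_iff[OF assms(1)] C_iff[OF assms(3)] assms(2) ab(3) by auto
  ultimately show ?thesis by (simp add: entry_def)
qed

lemma entry_C_V:
  assumes "j \<in> V" "j \<noteq> b" "i \<in> C"
  shows "E e i j = (if b < j then 1 else e) *
    (y ^ s i * (if j = a then 0 else F' (between V a j)) + y ^ (s i + 1) * F' (between V b j))"
proof -
  note btw = between_from_C[OF assms(3,1)]
  have "F (between U i j) = y ^ s i * F' (between U i j \<inter> V) + y ^ (s i + 1) * F' (between V b j)"
    using F_one[OF between_sub(1), of i j b] btw assms ab by (auto simp: s_def)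
  moreover have "F' (between U i j \<inter> V) = (if j = a then 0 else F' (between V a j))"
  proof (cases "j = a")
    case True
    have "k \<in> V \<Longrightarrow> (if i < a then i < k \<and> k < a else i < k \<or> k < a) \<longleftrightarrow> k \<noteq> a" for k
      using V_iff[of k] C_iff[OF assms(3)] ab(3) by (auto split: if_splits)
    then have "between U i a \<inter> V = V - {a}" unfolding between_def by blast
    then show ?thesis using True F'_between_same[OF ab(1)] by simp
  qed (use btw in simp)
  moreover have "i < j \<longleftrightarrow> b < j"
    using V_iff[OF assms(1)] C_iff[OF assms(3)] assms(2) ab(3) by auto
  ultimately show ?thesis by (simp add: entry_def)
qed

text \<open>The coefficients do not depend on \<open>i\<close>, so over \<open>V\<close> column
  \<open>j\<close> is a combination of columns \<open>a\<close> and \<open>b\<close>. Continuing to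
  \<open>b\<close> puts all of \<open>C\<close> on \<open>B\<close>, which contributes
  \<open>y ^ r\<close>; \<open>y' ^ r\<close> removes it and \<open>y ^ p j\<close> restores what is
  passed before \<open>j\<close>.\<close>

lemma entry_into_C:
  assumes "i \<in> V" "j \<in> C" "y' * y = 1"
  shows "E e i j = y ^ p j * y' ^ r * E e i b + y ^ (p j + 1) * E e i a"
proof -
  have yr: "y' ^ r * y ^ r = 1" using assms(3) by (metis power_mult_distrib power_one)
  show ?thesis
  proof (cases "i = a")
    case True
    then show ?thesis
      using yr entry_to_a[OF ab(1)] by (simp add: entry_a_C assms entry_a_b mult.assoc)
  next
    case False
    define P where "P = F' (between V i b)"
    define w where "w = (if i < a then 1 else e)"
    have "(if i < b then 1 else e) = w"
      using V_iff[OF assms(1)] False ab(3) by (auto simp: w_def)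
    moreover have "y ^ p j * y' ^ r * (w * (y ^ r * P)) = (y' ^ r * y ^ r) * (w * (y ^ p j * P))"
      by (simp only: mult_ac)
    ultimately show ?thesis
      using False unfolding entry_V_C[OF assms(1) False assms(2)] entry_to_a[OF assms(1)]
        entry_to_b[OF assms(1)] P_def[symmetric] w_def[symmetric] yr
      by (simp add: algebra_simps)
  qed
qed

text \<open>The mirror image: now \<open>b\<close> is the end point passed, and the two terms decide
  whether it is served by \<open>B\<close>.\<close>

lemma entry_from_C:
  assumes "j \<in> V" "i \<in> C" "y' * y = 1"
  shows "E e i j = y ^ s i * y' ^ r * E e a j + y ^ (s i + 1) * E e b j"
proof -
  have yr: "y' ^ r * y ^ r = 1" using assms(3) by (metis power_mult_distrib power_one)
  show ?thesis
  proof (cases "j = b")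
    case True
    then show ?thesis
      using yr entry_from_b[OF ab(2)] by (simp add: entry_C_b assms entry_a_b mult.assoc)
  next
    case False
    define P where "P = F' (between V a j)"
    define w where "w = (if b < j then 1 else e)"
    have "(if a < j then 1 else e) = w"
      using V_iff[OF assms(1)] False ab(3) by (auto simp: w_def)
    moreover have "y ^ s i * y' ^ r * (w * (y ^ r * P)) = (y' ^ r * y ^ r) * (w * (y ^ s i * P))"
      by (simp only: mult_ac)
    ultimately show ?thesis
      using False unfolding entry_C_V[OF assms(1) False assms(2)] entry_from_a[OF assms(1)]
        entry_from_b[OF assms(1)] P_def[symmetric] w_def[symmetric] yr
      by (simp add: algebra_simps)
  qed
qed

text \<open>For \<open>i < j\<close> only new vertices are passed. For \<open>j < i\<close> the walk
  goes around all of \<open>V\<close>, and the exponent counts the new vertices on both sides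
  together with \<open>a\<close> and \<open>b\<close>, which are forced onto
  \<open>B\<close>.\<close>

lemma entry_C_C:
  assumes "i \<in> C" "j \<in> C"
  shows "E e i j = (if i < j then y ^ card (C \<inter> {i<..<j}) else if i = j then 0
    else e * G * y ^ (s i + p j + 2))"
proof -
  note ij = C_iff[OF assms(1)] C_iff[OF assms(2)]
  consider "i < j" | "i = j" | "j < i" by linarith
  then show ?thesis
  proof cases
    case 1
    have "k \<in> V \<Longrightarrow> \<not> (i < k \<and> k < j)" for k
      using V_iff[of k] ij by auto
    then have *: "between U i j \<inter> V = {}" using 1 by (auto simp: between_def)
    then have "a \<notin> between U i j" "b \<notin> between U i j" using ab by auto
    moreover have "between U i j \<inter> C = C \<inter> {i<..<j}"
      using 1 U_eq by (auto simp: between_def)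
    ultimately show ?thesis using F_off[OF between_sub(1)] * 1 by (simp add: entry_def)
  next
    case 2
    then show ?thesis using entry_same[of i e] assms U_eq by simp
  next
    case 3
    have "k \<in> V \<Longrightarrow> i < k \<or> k < j" for k
      using V_iff[of k] ij by auto
    then have V: "V \<subseteq> between U i j" using 3 by (auto simp: between_def)
    have C: "between U i j \<inter> C = (C \<inter> {..<j}) \<union> (C \<inter> {i<..})"
      using 3 U_eq by (auto simp: between_def)
    have c: "card (between U i j \<inter> C) = p j + s i"
      unfolding C p_def s_def using C_facts(1) 3 by (subst card_Un_disjoint) auto
    \<comment> \<open>Since \<open>p i + s i = r - 1\<close>, strictness here yields exactly the two
      places in \<open>B\<close> needed for \<open>a\<close> and \<open>b\<close>.\<close>
    have "p j < p i" unfolding p_def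
      using 3 assms C_facts(1) by (intro psubset_card_mono) auto
    then have "p j + s i + 2 \<le> r" using p_s[OF assms(1)] by simp
    then have "F (between U i j) = y ^ (p j + s i + 2) * G"
      using F_all[OF V between_sub(1)] c by simp
    then show ?thesis using 3 by (simp add: entry_def mult_ac add_ac)
  qed
qed

end

text \<open>The number of vertices equals the total capacity, so every filling uses every piece to
  its limit and has this weight. The content is that for neighbouring \<open>a\<close> and
  \<open>b\<close> there is just one filling; the induction follows where the two neighbours lie
  relative to the last glued piece.\<close>

lemma fill_sum_consecutive:
  assumes "glued V D" "a \<in> V" "b \<in> V" "a < b" "V \<inter> {a<..<b} = {}"
  shows "fill_sum x D (V - {a, b}) = (\<Prod>A\<in>D. x A ^ (card A - 2))"
  using assms
proof (induction arbitrary: a b)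
  case (digon c d)
  then have *: "{c, d} - {a, b} = {}" by auto
  show ?case unfolding * by simp
next
  case (glue V D a b B a' b')
  interpret gluing V D a b B x
    using glue.hyps by (intro gluing_glued)
  have G: "F' (V - {a, b}) = (\<Prod>A\<in>D. x A ^ (card A - 2))"
    using glue.IH glue.hyps by blast
  have prod: "(\<Prod>A\<in>insert B D. x A ^ (card A - 2)) = y ^ r * (\<Prod>A\<in>D. x A ^ (card A - 2))"
    using finD B_notin_D C_facts(5) by simp
  have sub: "V \<union> B - {a', b'} \<subseteq> V \<union> C" using C_facts by auto
  have in': "a' \<in> V \<union> C" "b' \<in> V \<union> C" using glue.prems C_facts by auto
  have noC: "c \<in> V \<union> C \<Longrightarrow> c \<le> a' \<or> b' \<le> c" for c
    using glue.prems(4) C_facts(7) by (metis disjoint_iff greaterThanLessThan_iff not_le)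
  have CV: "c \<in> C \<Longrightarrow> c \<notin> V" for c using C_facts by blast
  have abC: "a \<notin> C" "b \<notin> C" using C_iff by blast+
  \<comment> \<open>An old and a new vertex can be neighbours only if the old one is an end point of
    the diagonal.\<close>
  consider "a' \<in> V" "b' \<in> V" | "a' \<in> C" "b' = b" | "a' = a" "b' \<in> C" | "a' \<in> C" "b' \<in> C"
  proof -
    have "b' = b" if "a' \<in> C" "b' \<in> V"
      using that noC[of b] C_iff[of a'] V_iff[of b'] ab glue.prems(3) by auto
    moreover have "a' = a" if "b' \<in> C" "a' \<in> V"
      using that noC[of a] C_iff[of b'] V_iff[of a'] ab glue.prems(3) by auto
    ultimately show ?thesis using in' that by blast
  qed
  then show ?case
  proof cases
    case 1
    then have "C \<subseteq> V \<union> B - {a', b'}" using C_facts by auto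
    moreover have "(V \<union> B - {a', b'}) \<inter> V = V - {a', b'}" by auto
    moreover have "F' (V - {a', b'}) = (\<Prod>A\<in>D. x A ^ (card A - 2))"
      using 1 glue.prems by (intro glue.IH) auto
    ultimately show ?thesis using F_full[OF sub] prod by simp
  next
    \<comment> \<open>The term that leaves \<open>a\<close> to the old pieces vanishes, since they
      would have to fill \<open>V - {b}\<close>. Hence \<open>a\<close> takes the place in
      \<open>B\<close> freed by \<open>a'\<close>.\<close>
    case 2
    then have "(V \<union> B - {a', b'}) \<inter> {a, b} = {a}" using ab CV C_facts by auto
    moreover have "\<not> C \<subseteq> V \<union> B - {a', b'}" using 2 by auto
    moreover have "(V \<union> B - {a', b'}) \<inter> C = C - {a'}" using 2 C_facts abC by auto
    moreover have "r = card (C - {a'}) + 1" using 2 C_facts by (simp add: r_def)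
    moreover have "(V \<union> B - {a', b'}) \<inter> V = V - {b}" using 2 CV by auto
    moreover have "V - {b} - {a} = V - {a, b}" by auto
    ultimately show ?thesis
      using F_one[OF sub] prod F'_between_same[OF ab(2)] G by simp
  next
    case 3
    then have "(V \<union> B - {a', b'}) \<inter> {a, b} = {b}" using ab CV C_facts by auto
    moreover have "\<not> C \<subseteq> V \<union> B - {a', b'}" using 3 by auto
    moreover have "(V \<union> B - {a', b'}) \<inter> C = C - {b'}" using 3 C_facts abC by auto
    moreover have "r = card (C - {b'}) + 1" using 3 C_facts by (simp add: r_def)
    moreover have "(V \<union> B - {a', b'}) \<inter> V = V - {a}" using 3 CV by auto
    moreover have "V - {a} - {b} = V - {a, b}" by auto
    ultimately show ?thesis
      using F_one[OF sub] prod F'_between_same[OF ab(1)] G by simp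
  next
    \<comment> \<open>Two new vertices are missing, so \<open>B\<close> has exactly two places left,
      one each for \<open>a\<close> and \<open>b\<close>.\<close>
    case 4
    have "V \<subseteq> V \<union> B - {a', b'}" using 4 CV by auto
    moreover have "(V \<union> B - {a', b'}) \<inter> C = C - {a', b'}" using C_facts by auto
    moreover have "card (C - {a', b'}) + 2 = r"
    proof -
      have c2: "card {a', b'} = 2" using glue.prems by simp
      have "card (C - {a', b'}) = r - 2"
        using 4 c2 unfolding r_def by (subst card_Diff_subset) auto
      moreover have "card {a', b'} \<le> r" unfolding r_def using 4 C_facts by (intro card_mono) auto
      ultimately show ?thesis using c2 by simp
    qed
    ultimately show ?thesis using F_all[OF _ sub] prod G by simp
  qed
qed

subsection \<open>Elimination of the glued polygon\<close>

context subring_of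
begin

text \<open>
  The matrix of a smaller polygon is kept inside a matrix of the full size; \<open>\<delta>\<close> collects the
  diagonal entries that have been split off already.
\<close>

definition framed :: "nat set \<Rightarrow> (nat \<Rightarrow> nat \<Rightarrow> 'a) \<Rightarrow> (nat \<Rightarrow> 'a) \<Rightarrow> nat \<Rightarrow> nat \<Rightarrow> 'a" where
  "framed V M \<delta> i j = (if i \<in> V \<and> j \<in> V then M i j else if i = j then \<delta> i else 0)"

text \<open>The matrix has zero diagonal and off-diagonal entries 1 and \<open>e\<close>. Three row
  additions exchange its rows up to one sign, which keeps the determinant -e.\<close>

lemma eqv_digon:
  assumes "a < b" "b < n"
  shows "eqv n (framed {a, b} (entry x {} {a, b} e) \<delta>) (framed {} (\<lambda>_ _. 0) (\<delta>(a := e, b := -1)))"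
proof -
  let ?M = "framed {a, b} (entry x {} {a, b} e) \<delta>"
  have "between {a, b} a b = {}" "between {a, b} b a = {}" "between {a, b} a a = {b}"
    "between {a, b} b b = {a}" using assms by (auto simp: between_def)
  then have entries: "entry x {} {a, b} e a b = 1" "entry x {} {a, b} e b a = e"
    "entry x {} {a, b} e a a = 0" "entry x {} {a, b} e b b = 0"
    using assms fill_sum_uncovered[of b "{b}" "{}" x] fill_sum_uncovered[of a "{a}" "{}" x]
    by (auto simp: entry_def)
  let ?M1 = "\<lambda>i j. if i = a then ?M i j + 1 * ?M b j else ?M i j"
  let ?M2 = "\<lambda>i j. if i = b then ?M1 i j + (-1) * ?M1 a j else ?M1 i j"
  let ?M3 = "\<lambda>i j. if i = a then ?M2 i j + 1 * ?M2 b j else ?M2 i j"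
  have "eqv n ?M ?M1" using assms one_in by (intro eqv_add_row) auto
  also have "eqv n ?M1 ?M2" using assms one_in uminus_in by (intro eqv_add_row) auto
  also have "eqv n ?M2 ?M3" using assms one_in by (intro eqv_add_row) auto
  finally show ?thesis
    by (rule eqv_cong_trans) (use assms entries in \<open>auto simp: framed_def\<close>)
qed

end

locale unit_gluing = subring_of R + gluing V D a b B x
  for R :: "'a::comm_ring_1 set" and V D a b B and x :: "nat set \<Rightarrow> 'a" +
  fixes n :: nat and y' e :: 'a
  assumes U_sub: "V \<union> B \<subseteq> {..<n}" and y_in: "x B \<in> R" and y'_in: "y' \<in> R" and inv: "y' * x B = 1"
begin

text \<open>Here \<open>G\<close> will turn out to be the monomial c of the old pieces and
  \<open>y ^ r\<close> is the factor contributed by \<open>B\<close>, so this is e * c * y^2 for the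
  glued dissection.\<close>

abbreviation "z \<equiv> e * G * y ^ (r + 2)"

text \<open>The Schur complement of the rows and columns \<open>a\<close>, \<open>b\<close> in the rows and columns of \<open>C\<close>.\<close>

definition "N i j = E e i j - y ^ p j * y' ^ r * E e i b - y ^ (p j + 1) * E e i a"

lemma y'_power: "y' ^ k * y ^ k = 1"
  using inv by (metis power_mult_distrib power_one)

lemma N_V: "i \<in> V \<Longrightarrow> j \<in> C \<Longrightarrow> N i j = 0"
  unfolding N_def using entry_into_C[OF _ _ inv, of i j e] by simp

lemma entry_C_a:
  assumes "i \<in> C"
  shows "E e i a = e * G * y ^ (s i + 1)"
  using entry_from_C[OF ab(1) assms inv, of e] entry_same[of a e] ab(1)
  by (simp add: entry_b_a mult_ac)

text \<open>After conjugation with the powers \<open>y ^ p i\<close> the two subtracted corrections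
  become the constants \<open>y'\<close> and \<open>y' * z\<close>. The walk entry cancels the first
  above the diagonal and the second below it; on the diagonal it is 0 and both remain.\<close>

lemma N_C:
  assumes "i \<in> C" "j \<in> C"
  shows "y ^ p i * N i j * y' ^ p j = - y' * (if i < j then z else if i = j then 1 + z else 1)"
proof -
  have pi: "p i + s i + 1 = r" and pj: "p j + s j + 1 = r" using p_s assms by auto
  have N: "N i j = E e i j - y ^ (p j + s i) * y' ^ r - e * G * y ^ (s i + p j + 2)"
    unfolding N_def entry_C_a[OF assms(1)] entry_C_b[OF assms(1)] by (simp add: power_add mult_ac)
  have y'r: "y' ^ r = y' ^ p i * y' ^ s i * y'" unfolding pi[symmetric] by (simp add: power_add)
  have 1: "y ^ p i * (y ^ (p j + s i) * y' ^ r) * y' ^ p j = y'"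
  proof -
    have "y ^ p i * (y ^ (p j + s i) * y' ^ r) * y' ^ p j =
      (y' ^ p i * y ^ p i) * (y' ^ s i * y ^ s i) * (y' ^ p j * y ^ p j) * y'"
      unfolding y'r power_add by (simp only: mult_ac)
    then show ?thesis by (simp add: y'_power)
  qed
  have 2: "y ^ p i * (e * G * y ^ (s i + p j + 2)) * y' ^ p j = y' * z"
  proof -
    have "y ^ p i * (e * G * y ^ (s i + p j + 2)) * y' ^ p j =
      e * G * y ^ (p i + s i + 2) * (y' ^ p j * y ^ p j)"
      by (simp only: power_add mult_ac)
    also have "\<dots> = e * G * y ^ (r + 1)" using pi by (simp add: y'_power)
    also have "\<dots> = y' * y * (e * G * y ^ (r + 1))" using inv by simp
    also have "\<dots> = y' * z" by (simp add: mult_ac)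
    finally show ?thesis .
  qed
  consider "i < j" | "i = j" | "j < i" by linarith
  then show ?thesis
  proof cases
    case 1
    have "C \<inter> {..<j} = (C \<inter> {..<i}) \<union> {i} \<union> (C \<inter> {i<..<j})" using 1 assms by auto
    then have "p j = card ((C \<inter> {..<i}) \<union> {i} \<union> (C \<inter> {i<..<j}))" by (simp only: p_def)
    also have "\<dots> = p i + 1 + card (C \<inter> {i<..<j})"
      unfolding p_def using C_facts(1) by (subst card_Un_disjoint, auto)+
    finally have pj': "p j = p i + 1 + card (C \<inter> {i<..<j})" .
    have "y ^ (p j + s i) * y' ^ r = y ^ card (C \<inter> {i<..<j}) * (y' ^ r * y ^ r)"
      unfolding pj' pi[symmetric] power_add by (simp only: mult_ac)
    then have "N i j = - (e * G * y ^ (s i + p j + 2))"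
      unfolding N using 1 by (simp add: entry_C_C[OF assms] y'_power)
    then show ?thesis using 1 2 by simp
  next
    case 2
    then have *: "N i j = - (y ^ (p j + s i) * y' ^ r) - e * G * y ^ (s i + p j + 2)"
      unfolding N entry_C_C[OF assms] by simp
    have "y ^ p i * N i j * y' ^ p j = - (y ^ p i * (y ^ (p j + s i) * y' ^ r) * y' ^ p j)
      - y ^ p i * (e * G * y ^ (s i + p j + 2)) * y' ^ p j"
      unfolding * by (simp only: right_diff_distrib left_diff_distrib mult_minus_right mult_minus_left)
    then show ?thesis unfolding 1 \<open>_ = y' * z\<close> using 2 by (simp add: algebra_simps)
  next
    case 3
    then have "N i j = - (y ^ (p j + s i) * y' ^ r)"
      unfolding N by (simp add: entry_C_C[OF assms])
    then have "y ^ p i * N i j * y' ^ p j = - (y ^ p i * (y ^ (p j + s i) * y' ^ r) * y' ^ p j)"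
      by simp
    then show ?thesis unfolding 1 using 3 by simp
  qed
qed

text \<open>The columns in \<open>C\<close> are cleared over \<open>V\<close> first. The row
  operations, whose sources are the rows \<open>a\<close> and \<open>b\<close>, then leave the block
  on \<open>C\<close> as it is.\<close>

lemma eqv_glue:
  assumes "e \<in> R" "G \<in> R"
  shows "eqv n (framed (V \<union> B) (E e) \<delta>)
    (framed V (entry x D V (e * y ^ r))
      (\<lambda>i. if i \<in> C then - y' * (if i = Min C then (\<Sum>t=0..r. z ^ t) else 1) else \<delta> i))"
proof -
  define M where "M = framed (V \<union> B) (E e) \<delta>"
  have CV: "C \<inter> V = {}" "C \<inter> {a, b} = {}" "C \<subseteq> {..<n}" "V \<subseteq> {..<n}" "a \<in> V" "b \<in> V" "a \<noteq> b"
    using C_facts ab U_sub by auto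
  have M: "i \<in> V \<union> C \<Longrightarrow> j \<in> V \<union> C \<Longrightarrow> M i j = E e i j"
    "i \<notin> V \<union> C \<or> j \<notin> V \<union> C \<Longrightarrow> M i j = (if i = j then \<delta> i else 0)" for i j
    using U_eq by (auto simp: M_def framed_def)
  \<comment> \<open>\<open>X\<close> and \<open>Z\<close> are the negated coefficients of
    \<open>entry_into_C\<close> and \<open>entry_from_C\<close>.\<close>
  define X where "X l j = (if l = b then - (y ^ p j * y' ^ r) else - (y ^ (p j + 1)))" for l j
  define Z where "Z i l = (if l = a then - (y ^ s i * y' ^ r) else - (y ^ (s i + 1)))" for i l
  define M1 where "M1 = (\<lambda>i j. if j \<in> C then M i j + (\<Sum>l\<in>{a, b}. X l j * M i l) else M i j)"
  define M2 where "M2 = (\<lambda>i j. if i \<in> C then M1 i j + (\<Sum>l\<in>{a, b}. Z i l * M1 l j) else M1 i j)"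
  \<comment> \<open>One conjugation does two jobs: on \<open>C\<close> it normalizes the Schur
    complement as in \<open>N_C\<close>, on \<open>V\<close> it moves the edge weight
    \<open>y ^ r\<close> into \<open>e\<close> as in \<open>entry_outer\<close>.\<close>
  define u where "u i = (if i \<in> C then y ^ p i else if i \<in> V \<and> b \<le> i then y ^ r else 1)" for i
  define u' where "u' i = (if i \<in> C then y' ^ p i else if i \<in> V \<and> b \<le> i then y' ^ r else 1)" for i
  define M3 where "M3 = (\<lambda>i j. u i * M2 i j * u' j)"
  have M1_C: "M1 i j = N i j" if "i \<in> V \<union> C" "j \<in> C" for i j
    using that CV by (simp add: M1_def X_def M N_def)
  have M1_V: "M1 i j = 0" if "i \<in> V" "j \<in> C" for i j
    using that N_V[OF that] M1_C[of i j] by simp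
  have M1_notin: "M1 i j = M i j" if "j \<notin> C" for i j
    using that by (simp add: M1_def)
  have M1_out: "M1 i j = (if i = j then \<delta> i else 0)" if "i \<notin> V \<union> C \<or> j \<notin> V \<union> C" for i j
  proof (cases "j \<in> C")
    case True
    with that have "i \<notin> V \<union> C" "i \<noteq> j" "i \<noteq> a" "i \<noteq> b" using CV by auto
    then show ?thesis using True CV(7) by (simp add: M1_def M)
  qed (use that M1_notin M in auto)
  have M2_C: "M2 i j = N i j" if "i \<in> C" "j \<in> C" for i j
    using that CV M1_V[of a j] M1_V[of b j] M1_C by (simp add: M2_def)
  have M2_CV: "M2 i j = 0" if "i \<in> C" "j \<in> V" for i j
  proof -
    have "j \<notin> C" using that CV by auto
    then show ?thesis
      using that CV entry_from_C[OF that(2,1) inv, of e] by (simp add: M2_def Z_def M1_notin M)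
  qed
  have M2_notin: "M2 i j = M1 i j" if "i \<notin> C" for i j
    using that by (simp add: M2_def)
  have M2_out: "M2 i j = (if i = j then \<delta> i else 0)" if "i \<notin> V \<union> C \<or> j \<notin> V \<union> C" for i j
  proof (cases "i \<in> C")
    case True
    with that have "j \<notin> V \<union> C" "i \<noteq> j" "a \<noteq> j" "b \<noteq> j" using CV by auto
    then show ?thesis using True CV(7) by (simp add: M2_def M1_out)
  qed (use that M2_notin M1_out in auto)
  have M2_V: "M2 i j = E e i j" if "i \<in> V" "j \<in> V" for i j
  proof -
    have "i \<notin> C" "j \<notin> C" using that CV by auto
    then show ?thesis using that by (simp add: M2_notin M1_notin M)
  qed
  have M3_zero: "M3 i j = 0" if "(i \<in> C) \<noteq> (j \<in> C)" for i j
  proof -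
    have "i \<noteq> j" using that by auto
    moreover have "M2 i j = 0" if "i \<in> V" "j \<in> C"
    proof -
      have "i \<notin> C" using that CV by auto
      then show ?thesis using that M2_notin M1_V by simp
    qed
    ultimately have "M2 i j = 0"
      using that CV M2_out[of i j] M2_CV[of i j] by auto
    then show ?thesis by (simp add: M3_def)
  qed
  have M3_V: "M3 i j = entry x D V (e * y ^ r) i j" if "i \<in> V" "j \<in> V" for i j
  proof -
    have ij: "i \<notin> C" "j \<notin> C" using that CV by auto
    have "M3 i j = (if b \<le> i then y ^ r else 1) * E e i j * (if b \<le> j then y' ^ r else 1)"
      using that ij by (simp add: M3_def M2_V u_def u'_def)
    also have "\<dots> = entry x D V (e * y ^ r) i j *
      ((if b \<le> j then y ^ r else 1) * (if b \<le> j then y' ^ r else 1))"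
      unfolding entry_outer[OF that] by (simp only: mult.assoc)
    also have "\<dots> = entry x D V (e * y ^ r) i j"
      using y'_power[of r] by (simp add: mult.commute)
    finally show ?thesis .
  qed
  have M3_out: "M3 i j = (if i = j then \<delta> i else 0)" if "i \<notin> V \<union> C \<or> j \<notin> V \<union> C" for i j
    using M2_out[OF that] that by (auto simp: M3_def u_def u'_def)
  have "eqv n M M1"
    unfolding M1_def using CV y_in y'_in
    by (intro eqv_col_combination) (auto simp: X_def intro!: uminus_in mult_in power_in)
  also have "eqv n M1 M2"
    unfolding M2_def using CV y_in y'_in
    by (intro eqv_row_combination) (auto simp: Z_def intro!: uminus_in mult_in power_in)
  also have "eqv n M2 M3"
    unfolding M3_def using y_in y'_in y'_power
    by (intro eqv_scale) (auto simp: u_def u'_def mult.commute intro!: one_in power_in)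
  also have "eqv n M3 (\<lambda>i j. if i \<in> C \<and> j \<in> C then
      (if i = j then - y' * (if i = Min C then (\<Sum>t=0..r. z ^ t) else 1) else 0) else M3 i j)"
    unfolding r_def
  proof (rule eqv_step_matrix)
    show "C \<noteq> {}" using C_facts(6) by (auto simp: r_def)
    show "C \<subseteq> {..<n}" by fact
    show "e * G * y ^ (card C + 2) \<in> R" "- y' \<in> R"
      using assms y_in y'_in by (auto intro!: mult_in power_in uminus_in)
    show "M3 i j = - y' * (if i < j then e * G * y ^ (card C + 2)
      else if i = j then 1 + e * G * y ^ (card C + 2) else 1)" if "i \<in> C" "j \<in> C" for i j
      using N_C[OF that] that by (simp add: M3_def M2_C u_def u'_def r_def)
    show "block n C M3" unfolding block_def using M3_zero by blast
  qed
  finally show ?thesis unfolding M_def[symmetric]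
  proof (rule eqv_cong_trans)
    show "(if i \<in> C \<and> j \<in> C then
      (if i = j then - y' * (if i = Min C then (\<Sum>t=0..r. z ^ t) else 1) else 0) else M3 i j) =
      framed V (entry x D V (e * y ^ r))
      (\<lambda>i. if i \<in> C then - y' * (if i = Min C then (\<Sum>t=0..r. z ^ t) else 1) else \<delta> i) i j" for i j
    proof -
      consider "i \<in> V" "j \<in> V" "i \<notin> C" "j \<notin> C" | "(i \<in> C) \<noteq> (j \<in> C)"
        | "i \<in> C" "j \<in> C" "i \<notin> V"
        | "i \<notin> C" "j \<notin> C" "i \<notin> V \<or> j \<notin> V" "i \<notin> V \<union> C \<or> j \<notin> V \<union> C"
        using CV(1) by blast
      then show ?thesis
      proof cases
        case 1
        then show ?thesis by (simp add: framed_def M3_V)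
      next
        case 2
        then have "\<not> (i \<in> V \<and> j \<in> V)" "\<not> (i \<in> C \<and> j \<in> C)" "i \<noteq> j" using CV(1) by auto
        then show ?thesis using M3_zero[OF 2] by (simp only: framed_def if_False)
      next
        case 3
        then show ?thesis by (simp add: framed_def)
      next
        case 4
        then show ?thesis using M3_out[OF 4(4)] by (simp only: framed_def if_False) auto
      qed
    qed
  qed
qed

end

section \<open>Induction over the gluing steps\<close>

context subring_of
begin

definition c_weight :: "(nat set \<Rightarrow> 'a) \<Rightarrow> nat set set \<Rightarrow> 'a" where
  "c_weight x D = (\<Prod>A\<in>D. x A ^ (card A - 2))"

definition piece_factor :: "(nat set \<Rightarrow> 'a) \<Rightarrow> nat set set \<Rightarrow> 'a \<Rightarrow> nat set \<Rightarrow> 'a" where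
  "piece_factor x D e A = (\<Sum>t=0..card A - 2. (e * c_weight x D * x A ^ 2) ^ t)"

text \<open>\<open>h\<close> gives each piece its own place on the diagonal, so the product over a
  fibre of \<open>h\<close> is one factor or empty; \<open>w\<close> collects the units, whose
  product keeps the sign and \<open>e\<close> for the determinant. Both \<open>e\<close> and
  \<open>\<delta>\<close> must vary: gluing replaces \<open>e\<close> by \<open>e * y ^ r\<close>
  and adds the entries split off to the frame.\<close>

lemma eqv_glued:
  assumes "glued V D" "V \<subseteq> {..<n}" "unit_in e" "\<And>A. A \<in> D \<Longrightarrow> unit_in (x A)"
  shows "\<exists>h w. inj_on h D \<and> h ` D \<subseteq> V \<and> (\<forall>i\<in>V. unit_in (w i)) \<and>
    (\<Prod>i\<in>V. w i) = (-1) ^ (card V - 1) * e \<and>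
    eqv n (framed V (entry x D V e) \<delta>)
      (framed {} (\<lambda>_ _. 0)
        (\<lambda>i. if i \<in> V then w i * (\<Prod>A\<in>{A \<in> D. h A = i}. piece_factor x D e A) else \<delta> i))"
  using assms
proof (induction arbitrary: e \<delta>)
  case (digon a b)
  have "eqv n (framed {a, b} (entry x {} {a, b} e) \<delta>) (framed {} (\<lambda>_ _. 0) (\<delta>(a := e, b := -1)))"
    using digon by (intro eqv_digon) auto
  moreover have "\<delta>(a := e, b := -1) =
    (\<lambda>i. if i \<in> {a, b} then (if i = a then e else -1) * (\<Prod>A\<in>{A \<in> {}. undefined = i}. piece_factor x {} e A) else \<delta> i)"
    using digon by auto
  moreover have "unit_in (- 1)" by (intro unit_in_uminus unit_in_one)
  ultimately show ?case using digon
    by (intro exI[of _ "\<lambda>_. undefined"] exI[of _ "\<lambda>i. if i = a then e else -1"]) auto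
next
  case (glue V D a b B)
  interpret gluing V D a b B x
    using glue.hyps by (intro gluing_glued)
  have "unit_in y" using glue.prems by auto
  then obtain y' where y': "y \<in> R" "y' \<in> R" "y' * y = 1" "unit_in y'"
    by (rule unit_in_obtain) auto
  have e: "e \<in> R" using glue.prems(2) by (auto simp: unit_in_def)
  interpret unit_gluing R V D a b B x n y' e
    using glue.prems y' by unfold_locales auto
  have G: "G = c_weight x D"
    unfolding c_weight_def using glue.hyps by (intro fill_sum_consecutive)
  have "unit_in (c_weight x D)" unfolding c_weight_def
    using glue.prems by (intro unit_in_prod unit_in_power) auto
  then have "G \<in> R" using G by (auto simp: unit_in_def)
  \<comment> \<open>The entries split off by this gluing step enter the induction hypothesis as part
    of the frame.\<close>
  let ?\<delta> = "\<lambda>i. if i \<in> C then - y' * (if i = Min C then (\<Sum>t=0..r. z ^ t) else 1) else \<delta> i"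
  obtain h w where h: "inj_on h D" "h ` D \<subseteq> V" and w: "\<forall>i\<in>V. unit_in (w i)"
    "(\<Prod>i\<in>V. w i) = (-1) ^ (card V - 1) * (e * y ^ r)" and
    eqv: "eqv n (framed V (entry x D V (e * y ^ r)) ?\<delta>)
      (framed {} (\<lambda>_ _. 0) (\<lambda>i. if i \<in> V then
        w i * (\<Prod>A\<in>{A \<in> D. h A = i}. piece_factor x D (e * y ^ r) A) else ?\<delta> i))"
  proof -
    have "V \<subseteq> {..<n}" "unit_in (e * y ^ r)"
      using glue.prems by (auto intro: unit_in_mult unit_in_power)
    then have "\<exists>h w. inj_on h D \<and> h ` D \<subseteq> V \<and> (\<forall>i\<in>V. unit_in (w i)) \<and>
      (\<Prod>i\<in>V. w i) = (-1) ^ (card V - 1) * (e * y ^ r) \<and>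
      eqv n (framed V (entry x D V (e * y ^ r)) ?\<delta>) (framed {} (\<lambda>_ _. 0) (\<lambda>i. if i \<in> V then
        w i * (\<Prod>A\<in>{A \<in> D. h A = i}. piece_factor x D (e * y ^ r) A) else ?\<delta> i))"
      using glue.prems(3) by (intro glue.IH) auto
    then show thesis by (elim exE conjE) (rule that)
  qed
  have c: "c_weight x (insert B D) = y ^ r * c_weight x D"
    using finD B_notin_D C_facts(5) by (simp add: c_weight_def)
  have pf: "piece_factor x D (e * y ^ r) A = piece_factor x (insert B D) e A" for A
    by (simp add: piece_factor_def c mult_ac)
  have pf_B: "(\<Sum>t=0..r. z ^ t) = piece_factor x (insert B D) e B"
    by (simp add: piece_factor_def c G C_facts(5) power_add mult_ac power2_eq_square)
  \<comment> \<open>\<open>Min C\<close> is where the diagonalization of the step matrix leaves the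
    geometric sum.\<close>
  define h' where "h' = h(B := Min C)"
  define w' where "w' i = (if i \<in> C then - y' else w i)" for i
  have Min: "Min C \<in> C" using C_facts(1,6) by (intro Min_in) (auto simp: r_def)
  have CV: "C \<inter> V = {}" using C_facts by auto
  have hV: "h A \<in> V" if "A \<in> D" for A using that h by auto
  have h'_D: "h' A = h A" if "A \<in> D" for A using that B_notin_D by (auto simp: h'_def)
  have h'_B: "h' B = Min C" by (simp add: h'_def)
  have "Min C \<notin> h ` D" using h(2) Min CV by blast
  then have "Min C \<notin> h' ` (D - {B})" using h'_D by (metis (no_types, lifting) DiffD1 imageE imageI)
  moreover have "inj_on h' D" using h(1) h'_D by (simp add: inj_on_def)
  ultimately have "inj_on h' (insert B D)" unfolding inj_on_insert h'_B by (intro conjI)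
  moreover have "h' ` insert B D \<subseteq> U"
    using hV h'_D h'_B Min unfolding U_eq by auto
  moreover have "unit_in (w' i)" if "i \<in> U" for i
  proof (cases "i \<in> C")
    case True
    then show ?thesis using unit_in_uminus[OF y'(4)] by (simp add: w'_def)
  next
    case False
    then have "i \<in> V" using that unfolding U_eq by blast
    then show ?thesis using w(1) False by (simp add: w'_def)
  qed
  \<comment> \<open>The \<open>r\<close> new units \<open>- y'\<close> cancel the factor
    \<open>y ^ r\<close> in the edge weight of the smaller polygon and supply the sign for
    \<open>r\<close> further vertices.\<close>
  moreover have "(\<Prod>i\<in>U. w' i) = (-1) ^ (card U - 1) * e"
  proof -
    have "(\<Prod>i\<in>U. w' i) = (\<Prod>i\<in>V. w' i) * (\<Prod>i\<in>C. w' i)"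
      unfolding U_eq using finV C_facts(1,3) by (intro prod.union_disjoint)
    also have "(\<Prod>i\<in>V. w' i) = (\<Prod>i\<in>V. w i)"
      using CV by (intro prod.cong) (auto simp: w'_def)
    also have "(\<Prod>i\<in>C. w' i) = (- y') ^ r"
      by (simp add: w'_def r_def)
    also have "(- y') ^ r = (-1) ^ r * y' ^ r" by (rule power_minus)
    also have "(\<Prod>i\<in>V. w i) * ((-1) ^ r * y' ^ r) = (-1) ^ (card V - 1) * (-1) ^ r * (y' ^ r * y ^ r) * e"
      unfolding w(2) by (simp only: mult_ac)
    also have "\<dots> = (-1) ^ (card V - 1 + r) * e"
      by (simp add: y'_power power_add)
    also have "card V - 1 + r = card U - 1"
    proof -
      have "card U = card V + r" unfolding U_eq using finV C_facts by (simp add: card_Un_disjoint r_def)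
      then show ?thesis using capacity by simp
    qed
    finally show ?thesis .
  qed
  moreover have "eqv n (framed U (E e) \<delta>) (framed {} (\<lambda>_ _. 0) (\<lambda>i. if i \<in> U then
        w' i * (\<Prod>A\<in>{A \<in> insert B D. h' A = i}. piece_factor x (insert B D) e A) else \<delta> i))"
  proof (rule eqv_cong_trans[OF eqv_trans[OF eqv_glue[OF e \<open>G \<in> R\<close>] eqv]])
    fix i j
    consider "i \<in> V" | "i \<in> C" | "i \<notin> U" using U_eq by auto
    then have eq: "(if i \<in> V then w i * (\<Prod>A\<in>{A \<in> D. h A = i}. piece_factor x D (e * y ^ r) A) else ?\<delta> i) =
      (if i \<in> U then w' i * (\<Prod>A\<in>{A \<in> insert B D. h' A = i}. piece_factor x (insert B D) e A) else \<delta> i)"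
    proof cases
      case 1
      then have "i \<notin> C" "i \<noteq> Min C" using CV Min by auto
      then have "{A \<in> insert B D. h' A = i} = {A \<in> D. h A = i}"
        using B_notin_D by (auto simp: h'_def)
      with 1 \<open>i \<notin> C\<close> show ?thesis by (simp add: w'_def pf)
    next
      case 2
      then have "i \<notin> V" using CV by auto
      then have *: "h A \<noteq> i" if "A \<in> D" for A using hV that by blast
      have "{A \<in> insert B D. h' A = i} = (if i = Min C then {B} else {})"
        using * B_notin_D by (auto simp: h'_def)
      with 2 \<open>i \<notin> V\<close> show ?thesis unfolding pf_B using U_eq by (simp add: w'_def)
    qed (use U_eq in auto)
    show "framed {} (\<lambda>_ _. 0) (\<lambda>i. if i \<in> V then
        w i * (\<Prod>A\<in>{A \<in> D. h A = i}. piece_factor x D (e * y ^ r) A) else ?\<delta> i) i j =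
      framed {} (\<lambda>_ _. 0) (\<lambda>i. if i \<in> U then
        w' i * (\<Prod>A\<in>{A \<in> insert B D. h' A = i}. piece_factor x (insert B D) e A) else \<delta> i) i j"
      by (simp only: framed_def eq)
  qed
  ultimately show ?case by (intro exI[of _ h'] exI[of _ w'] conjI ballI)
qed

end

subsection \<open>Dissections arise by gluing\<close>

text \<open>Cutting off an ear leaves gaps in the labels, so the notion is needed for arbitrary
  vertex sets. The pair \<open>(Min V, Max V)\<close> is excluded because it is the boundary edge
  closing the polygon.\<close>

definition dissection_on :: "nat set \<Rightarrow> (nat \<times> nat) set \<Rightarrow> bool" where
  "dissection_on V E \<longleftrightarrow>
     (\<forall>(a, b)\<in>E. a \<in> V \<and> b \<in> V \<and> a < b \<and> V \<inter> {a<..<b} \<noteq> {} \<and> (a, b) \<noteq> (Min V, Max V)) \<and>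
     (\<forall>e\<in>E. \<forall>f\<in>E. \<not> crossing e f)"

definition sides_on :: "nat set \<Rightarrow> nat \<times> nat \<Rightarrow> nat set set" where
  "sides_on V e = {V \<inter> {fst e..snd e}, V - {fst e<..<snd e}}"

definition pieces_on :: "nat set \<Rightarrow> (nat \<times> nat) set \<Rightarrow> nat set set" where
  "pieces_on V E = {A. 3 \<le> card A \<and> (\<exists>H. (\<forall>e\<in>E. H e \<in> sides_on V e) \<and> A = V \<inter> (\<Inter>e\<in>E. H e))}"

lemma pieces_onI:
  "3 \<le> card A \<Longrightarrow> (\<And>e. e \<in> E \<Longrightarrow> H e \<in> sides_on V e) \<Longrightarrow> A = V \<inter> (\<Inter>e\<in>E. H e) \<Longrightarrow> A \<in> pieces_on V E"
  unfolding pieces_on_def by blast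

text \<open>By \<open>rel\<close>, every other diagonal has the ear entirely on one side, and its
  other side meets the ear at most in \<open>a\<close> and \<open>b\<close>. So inside the ear only
  one choice of sides leaves three vertices, while outside it sides of \<open>V\<close> and of the
  remaining polygon correspond by restriction.\<close>

lemma pieces_on_ear:
  assumes "finite V" and e: "(a, b) \<in> E" "a \<in> V" "b \<in> V" "c \<in> V" "a < c" "c < b"
    and rel: "\<And>a' b'. (a', b') \<in> E - {(a, b)} \<Longrightarrow> a' \<le> a \<and> b \<le> b' \<or> b' \<le> a \<or> b \<le> a'"
  shows "pieces_on V E =
    insert (V \<inter> {a..b}) (pieces_on (V - {a<..<b}) (E - {(a, b)}))" (is "_ = insert ?B (pieces_on ?V ?E)")
proof -
  have side: "?B \<subseteq> S \<or> S \<inter> ?B \<subseteq> {a, b}" "\<exists>S'\<in>sides_on V f. ?B \<subseteq> S'"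
    if "f \<in> E" "S \<in> sides_on V f" for f S
  proof -
    obtain a' b' where f: "f = (a', b')" by (cases f)
    have "(a', b') = (a, b) \<or> a' \<le> a \<and> b \<le> b' \<or> b' \<le> a \<or> b \<le> a'"
      using rel[of a' b'] that(1) f by auto
    then have "?B \<subseteq> V \<inter> {a'..b'} \<and> (V - {a'<..<b'}) \<inter> ?B \<subseteq> {a, b} \<or>
      ?B \<subseteq> V - {a'<..<b'} \<and> V \<inter> {a'..b'} \<inter> ?B \<subseteq> {a, b}"
      using e by fastforce
    with that(2) f show "?B \<subseteq> S \<or> S \<inter> ?B \<subseteq> {a, b}" "\<exists>S'\<in>sides_on V f. ?B \<subseteq> S'"
      by (auto simp: sides_on_def)
  qed
  have "card {a, c, b} \<le> card ?B" using e assms(1) by (intro card_mono) auto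
  then have card_B: "3 \<le> card ?B" using e by simp
  have side_e: "sides_on V (a, b) = {?B, ?V}" by (simp add: sides_on_def)
  show ?thesis
  proof (intro equalityI subsetI)
    fix A assume "A \<in> pieces_on V E"
    then obtain H where A: "3 \<le> card A" "A = V \<inter> (\<Inter>e\<in>E. H e)" and H: "\<And>f. f \<in> E \<Longrightarrow> H f \<in> sides_on V f"
      unfolding pieces_on_def by auto
    from H[OF e(1)] consider "H (a, b) = ?B" | "H (a, b) = ?V" unfolding side_e by blast
    then show "A \<in> insert ?B (pieces_on ?V ?E)"
    proof cases
      case 1
      have "A \<subseteq> ?B" using A(2) 1 e(1) by blast
      have "?B \<subseteq> H f" if "f \<in> E" for f
      proof (rule ccontr)
        assume "\<not> ?B \<subseteq> H f"
        then have "H f \<inter> ?B \<subseteq> {a, b}" using side(1)[OF that H[OF that]] by blast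
        then have "A \<subseteq> {a, b}" using \<open>A \<subseteq> ?B\<close> A(2) that by blast
        then have "card A \<le> card {a, b}" by (intro card_mono) auto
        also have "\<dots> \<le> 2" by (simp add: card_insert_if)
        finally show False using A(1) by simp
      qed
      then have "?B \<subseteq> A" using A(2) by blast
      with \<open>A \<subseteq> ?B\<close> show ?thesis by blast
    next
      case 2
      have "A \<in> pieces_on ?V ?E"
      proof (rule pieces_onI[OF A(1)])
        show "?V \<inter> H f \<in> sides_on ?V f" if "f \<in> ?E" for f
          using H[of f] that unfolding sides_on_def by auto
        show "A = ?V \<inter> (\<Inter>f\<in>?E. ?V \<inter> H f)" using A(2) 2 e(1) by blast
      qed
      then show ?thesis by blast
    qed
  next
    fix A assume "A \<in> insert ?B (pieces_on ?V ?E)"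
    then consider "A = ?B" | "A \<in> pieces_on ?V ?E" by blast
    then show "A \<in> pieces_on V E"
    proof cases
      case 1
      define H where "H f = (if f = (a, b) then ?B else SOME S. S \<in> sides_on V f \<and> ?B \<subseteq> S)" for f
      have H: "H f \<in> sides_on V f \<and> ?B \<subseteq> H f" if "f \<in> E" for f
      proof (cases "f = (a, b)")
        case False
        have "\<exists>S. S \<in> sides_on V f \<and> ?B \<subseteq> S"
          using side(2)[OF that, of "V \<inter> {fst f..snd f}"] by (auto simp: sides_on_def)
        from someI_ex[OF this] False show ?thesis by (simp add: H_def)
      qed (simp add: H_def side_e)
      show ?thesis
      proof (rule pieces_onI[of _ _ H])
        show "A = V \<inter> (\<Inter>f\<in>E. H f)"
        proof
          show "A \<subseteq> V \<inter> (\<Inter>f\<in>E. H f)" using H 1 by blast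
          have "H (a, b) = A" using 1 by (simp add: H_def)
          then show "V \<inter> (\<Inter>f\<in>E. H f) \<subseteq> A" using e(1) by blast
        qed
      qed (use 1 card_B H in auto)
    next
      case 2
      then obtain H' where A: "3 \<le> card A" "A = ?V \<inter> (\<Inter>e\<in>?E. H' e)" and
        H': "\<And>f. f \<in> ?E \<Longrightarrow> H' f \<in> sides_on ?V f"
        unfolding pieces_on_def by auto
      \<comment> \<open>Each side of the smaller polygon is lifted to a side of \<open>V\<close>
        whose trace it is.\<close>
      define H where "H f = (if f = (a, b) then ?V else
        if H' f = ?V \<inter> {fst f..snd f} then V \<inter> {fst f..snd f} else V - {fst f<..<snd f})" for f
      have HH': "?V \<inter> H f = H' f" if "f \<in> ?E" for f
        using H'[OF that] that by (auto simp: H_def sides_on_def)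
      show ?thesis
      proof (rule pieces_onI[of _ _ H])
        show "H f \<in> sides_on V f" if "f \<in> E" for f
          by (auto simp: H_def sides_on_def)
        have "H (a, b) = ?V" by (simp add: H_def)
        then show "A = V \<inter> (\<Inter>f\<in>E. H f)" using A(2) HH' e(1) by blast
      qed (use A in auto)
    qed
  qed
qed

text \<open>A diagonal of minimal length cuts off an ear, because a diagonal nested below it would
  be shorter. With no diagonal left, the whole polygon is glued onto the digon of its smallest and
  largest vertex.\<close>

lemma glued_pieces_on:
  assumes "finite V" "3 \<le> card V" "dissection_on V E"
  shows "glued V (pieces_on V E)"
  using assms
proof (induction "card E" arbitrary: V E rule: less_induct)
  case less
  have "E \<subseteq> V \<times> V" using less.prems(3) by (auto simp: dissection_on_def)
  then have finE: "finite E" using less.prems(1) finite_subset by blast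
  have ne: "V \<noteq> {}" using less.prems(2) by auto
  define l u where "l = Min V" and "u = Max V"
  have lu: "l \<in> V" "u \<in> V" "\<And>k. k \<in> V \<Longrightarrow> l \<le> k \<and> k \<le> u"
    using less.prems(1) ne by (auto simp: l_def u_def)
  have "l \<noteq> u"
  proof
    assume "l = u"
    then have "V \<subseteq> {l}" using lu(3) by force
    then have "card V \<le> 1" using card_mono[of "{l}" V] by auto
    then show False using less.prems(2) by simp
  qed
  then have "l < u" using lu by fastforce
  show ?case
  proof (cases "E = {}")
    case True
    have "glued ({l, u} \<union> V) (insert V {})"
      by (rule glue[OF digon[OF \<open>l < u\<close>], of l u V]) (use lu \<open>l < u\<close> less.prems in auto)
    moreover have "{l, u} \<union> V = V" using lu by auto
    moreover have "pieces_on V E = {V}" using True less.prems(2) by (auto simp: pieces_on_def)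
    ultimately show ?thesis by simp
  next
    case False
    define len where "len = (\<lambda>f :: nat \<times> nat. snd f - fst f)"
    obtain e where e: "e \<in> E" "\<And>f. f \<in> E \<Longrightarrow> len e \<le> len f"
      using arg_min_if_finite[OF finE False, of len] by (metis not_le)
    obtain a b where ab: "e = (a, b)" by (cases e)
    note D = less.prems(3)[unfolded dissection_on_def]
    have abV: "a \<in> V" "b \<in> V" "a < b" "(a, b) \<noteq> (l, u)" "V \<inter> {a<..<b} \<noteq> {}"
      using D e(1) ab by (auto simp: l_def u_def)
    then obtain c where c: "c \<in> V" "a < c" "c < b" by auto
    have rel: "a' \<le> a \<and> b \<le> b' \<or> b' \<le> a \<or> b \<le> a'" if "(a', b') \<in> E - {(a, b)}" for a' b'
    proof -
      have "\<not> crossing (a, b) (a', b')" "b - a \<le> b' - a'" "a' < b'"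
        using that D e ab by (auto simp: len_def)
      then show ?thesis using that abV(3) unfolding crossing_def by auto
    qed
    define V' where "V' = V - {a<..<b}"
    define E' where "E' = E - {(a, b)}"
    have in': "a \<in> V'" "b \<in> V'" "l \<in> V'" "u \<in> V'"
      using abV lu by (auto simp: V'_def dest!: lu(3))
    have finV': "finite V'" "V' \<subseteq> V" using less.prems(1) by (auto simp: V'_def)
    have MinMax: "Min V' = l" "Max V' = u"
      using finV' in' lu by (auto intro!: Min_eqI Max_eqI)
    \<comment> \<open>Since \<open>ab\<close> is not the closing edge, the rest keeps a third
      vertex.\<close>
    have "l < a \<or> b < u" using abV lu(3)[of a] lu(3)[of b] by auto
    then have "3 \<le> card V'"
    proof
      assume "l < a"
      have "card {l, a, b} \<le> card V'" using in' finV' by (intro card_mono) auto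
      with \<open>l < a\<close> abV show ?thesis by simp
    next
      assume "b < u"
      have "card {a, b, u} \<le> card V'" using in' finV' by (intro card_mono) auto
      with \<open>b < u\<close> abV show ?thesis by simp
    qed
    moreover have "dissection_on V' E'"
      unfolding dissection_on_def MinMax
    proof (intro conjI ballI, clarify)
      fix a' b' assume f: "(a', b') \<in> E'"
      then have f': "(a', b') \<in> E" by (simp add: E'_def)
      have D': "a' \<in> V" "b' \<in> V" "a' < b'" "V \<inter> {a'<..<b'} \<noteq> {}" "(a', b') \<noteq> (l, u)"
        using D f' by (auto simp: l_def u_def)
      then obtain k where k: "k \<in> V" "a' < k" "k < b'" by auto
      have r: "a' \<le> a \<and> b \<le> b' \<or> b' \<le> a \<or> b \<le> a'" using rel f by (simp add: E'_def)
      \<comment> \<open>A remaining diagonal must not become an edge: if it encloses the ear,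
        \<open>a\<close> or \<open>b\<close> lies strictly below it; otherwise its old witness
        \<open>k\<close> survives.\<close>
      have "V' \<inter> {a'<..<b'} \<noteq> {}"
      proof (cases "a' \<le> a \<and> b \<le> b'")
        case True
        then have "a' < a \<or> b < b'" using f by (auto simp: E'_def)
        then have "a \<in> V' \<inter> {a'<..<b'} \<or> b \<in> V' \<inter> {a'<..<b'}" using True in' abV(3) by auto
        then show ?thesis by blast
      next
        case False
        then have "k \<in> V' \<inter> {a'<..<b'}" using r k by (auto simp: V'_def)
        then show ?thesis by blast
      qed
      moreover have "a' \<in> V'" "b' \<in> V'" using D' r abV(3) by (auto simp: V'_def)
      ultimately show "a' \<in> V' \<and> b' \<in> V' \<and> a' < b' \<and> V' \<inter> {a'<..<b'} \<noteq> {} \<and> (a', b') \<noteq> (l, u)"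
        using D' by blast
    qed (use D in \<open>auto simp: E'_def\<close>)
    moreover have "card E' < card E"
      using card_Diff1_less[OF finE e(1)] by (simp only: E'_def ab)
    ultimately have "glued V' (pieces_on V' E')" using finV' less.hyps by blast
    moreover have "card {a, c, b} \<le> card (V \<inter> {a..b})"
      using c abV less.prems(1) by (intro card_mono) auto
    then have "3 \<le> card (V \<inter> {a..b})" using c by simp
    ultimately have "glued (V' \<union> (V \<inter> {a..b})) (insert (V \<inter> {a..b}) (pieces_on V' E'))"
      using in' abV by (intro glue) (auto simp: V'_def)
    moreover have "V' \<union> (V \<inter> {a..b}) = V" by (auto simp: V'_def)
    moreover have "pieces_on V E = insert (V \<inter> {a..b}) (pieces_on V' E')"
      unfolding V'_def E'_def using e(1) ab abV c less.prems(1) rel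
      by (intro pieces_on_ear[of V a b E c]) auto
    ultimately show ?thesis by simp
  qed
qed

lemma glued_pieces:
  assumes "3 \<le> n" "dissection n E"
  shows "glued {..<n} (pieces n E)"
proof -
  have mm: "Min {..<n} = 0" "Max {..<n} = n - 1"
    using assms(1) by (auto intro!: Min_eqI Max_eqI)
  have E: "a + 1 < b" "b < n" "(a, b) \<noteq> (0, n - 1)" if "(a, b) \<in> E" for a b
    using assms(2) that by (auto simp: dissection_def diagonals_def)
  have "dissection_on {..<n} E"
    unfolding dissection_on_def mm
  proof (intro conjI ballI, clarify)
    fix a b assume ab: "(a, b) \<in> E"
    have "a + 1 \<in> {..<n} \<inter> {a<..<b}" using E[OF ab] by simp
    then have "{..<n} \<inter> {a<..<b} \<noteq> {}" by blast
    then show "a \<in> {..<n} \<and> b \<in> {..<n} \<and> a < b \<and> {..<n} \<inter> {a<..<b} \<noteq> {} \<and> (a, b) \<noteq> (0, n - 1)"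
      using E[OF ab] by simp
  next
    show "\<not> crossing e f" if "e \<in> E" "f \<in> E" for e f
      using assms(2) that by (simp add: dissection_def)
  qed
  then have "glued {..<n} (pieces_on {..<n} E)" using assms(1) by (intro glued_pieces_on) auto
  moreover have "sides_on {..<n} e = sides n e" if "e \<in> E" for e
  proof -
    have "snd e < n" using E[of "fst e" "snd e"] that by simp
    then have "{..<n} \<inter> {fst e..snd e} = {fst e..snd e}" by auto
    then show ?thesis by (simp add: sides_on_def sides_def)
  qed
  then have "pieces_on {..<n} E = pieces n E"
    unfolding pieces_on_def pieces_def by (simp cong: ball_cong)
  ultimately show ?thesis by simp
qed

subsection \<open>Walks and weights\<close>

lemma ccw_dist_eq:
  assumes "i < n" "j < n" "i \<noteq> j"
  shows "ccw_dist n i j = (if i < j then j - i else n + j - i)"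
proof (cases "i < j")
  case True
  then have "n + j - i = (j - i) + n" by simp
  then have "(n + j - i) mod n = (j - i) mod n" by (metis mod_add_self2)
  then show ?thesis using True assms by (simp add: ccw_dist_def)
qed (use assms in \<open>auto simp: ccw_dist_def\<close>)

lemma shift_mod:
  assumes "(i :: nat) < n" "t < n"
  shows "(i + 1 + t) mod n = (if i + 1 + t < n then i + 1 + t else i + 1 + t - n)"
proof (cases "i + 1 + t < n")
  case False
  then have "(i + 1 + t) mod n = (i + 1 + t - n) mod n" by (intro le_mod_geq) simp
  also have "\<dots> = i + 1 + t - n" using assms by (intro mod_less) linarith
  finally show ?thesis using False by simp
qed simp

lemma bij_betw_between:
  assumes "i < n" "j < n" "i \<noteq> j"
  shows "bij_betw (\<lambda>t. (i + 1 + t) mod n) {..<ccw_dist n i j - 1} (between {..<n} i j)"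
proof (rule bij_betw_byWitness[where f' = "\<lambda>k. if i < k then k - i - 1 else n + k - i - 1"])
  note d = ccw_dist_eq[OF assms]
  have t: "t < n" if "t < ccw_dist n i j - 1" for t using that assms by (auto simp: d split: if_splits)
  show "\<forall>t\<in>{..<ccw_dist n i j - 1}. (if i < (i + 1 + t) mod n then (i + 1 + t) mod n - i - 1
      else n + (i + 1 + t) mod n - i - 1) = t"
  proof
    fix s assume "s \<in> {..<ccw_dist n i j - 1}"
    then have s: "s < ccw_dist n i j - 1" by simp
    show "(if i < (i + 1 + s) mod n then (i + 1 + s) mod n - i - 1
      else n + (i + 1 + s) mod n - i - 1) = s"
      using t[OF s] assms unfolding shift_mod[OF assms(1) t[OF s]] by auto
  qed
  show "\<forall>k\<in>between {..<n} i j. (i + 1 + (if i < k then k - i - 1 else n + k - i - 1)) mod n = k"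
    using assms by (auto simp: between_def split: if_splits)
  show "(\<lambda>t. (i + 1 + t) mod n) ` {..<ccw_dist n i j - 1} \<subseteq> between {..<n} i j"
  proof clarify
    fix t assume "t < ccw_dist n i j - 1"
    with t[OF this] show "(i + 1 + t) mod n \<in> between {..<n} i j"
      using assms unfolding shift_mod[OF assms(1) t[OF \<open>t < ccw_dist n i j - 1\<close>]]
      by (auto simp: between_def d split: if_splits)
  qed
  show "(\<lambda>k. if i < k then k - i - 1 else n + k - i - 1) ` between {..<n} i j \<subseteq> {..<ccw_dist n i j - 1}"
    using assms by (auto simp: between_def d split: if_splits)
qed

lemma count_list_eq_card: "count_list w A = card {t. t < length w \<and> w ! t = A}"
  unfolding count_list_eq_length_filter length_filter_conv_card by (metis (full_types))

text \<open>Walks are indexed by position, fillings by vertex. The bijection \<open>\<tau>\<close>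
  from positions to vertices passed turns multiplicities in a list into sizes of fibres.\<close>

lemma sum_walks:
  fixes x :: "nat set \<Rightarrow> 'a::comm_ring_1"
  assumes "i < n" "j < n" "i \<noteq> j"
  shows "(\<Sum>w\<in>walks n D i j. \<Prod>t<length w. x (w ! t)) = fill_sum x D (between {..<n} i j)"
proof -
  define L where "L = ccw_dist n i j - 1"
  define \<tau> where "\<tau> t = (i + 1 + t) mod n" for t
  define I where "I = between {..<n} i j"
  define \<sigma> where "\<sigma> = the_inv_into {..<L} \<tau>"
  have bij: "bij_betw \<tau> {..<L} I"
    using bij_betw_between[OF assms] by (simp add: \<tau>_def[abs_def] L_def I_def)
  have \<sigma>: "\<sigma> k < L" "\<tau> (\<sigma> k) = k" if "k \<in> I" for k
    using that bij f_the_inv_into_f_bij_betw[OF bij] bij_betwE[OF bij_betw_the_inv_into[OF bij]]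
    by (auto simp: \<sigma>_def)
  have \<tau>: "\<tau> t \<in> I" "\<sigma> (\<tau> t) = t" if "t < L" for t
    using that bij by (auto simp: \<sigma>_def bij_betw_def the_inv_into_f_f)
  have walks: "walks n D i j = {w. length w = L \<and> set w \<subseteq> D \<and> (\<forall>t<L. \<tau> t \<in> w ! t) \<and>
      (\<forall>A\<in>D. card {t. t < L \<and> w ! t = A} \<le> card A - 2)}"
    unfolding walks_def L_def \<tau>_def using assms(3) by (auto simp: count_list_eq_card)
  have card_eq: "card {t. t < L \<and> P (\<tau> t)} = card {k \<in> I. P k}" for P
  proof (rule bij_betw_same_card)
    show "bij_betw \<tau> {t. t < L \<and> P (\<tau> t)} {k \<in> I. P k}"
      using \<tau> \<sigma> by (intro bij_betw_byWitness[where f' = \<sigma>]) auto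
  qed
  show ?thesis unfolding fill_sum_def I_def[symmetric]
  proof (rule sum.reindex_bij_witness[where j = "\<lambda>w. \<lambda>k\<in>I. w ! \<sigma> k" and i = "\<lambda>p. map (\<lambda>t. p (\<tau> t)) [0..<L]"])
    fix w assume w: "w \<in> walks n D i j"
    then have len: "length w = L" by (simp add: walks)
    show "map (\<lambda>t. (\<lambda>k\<in>I. w ! \<sigma> k) (\<tau> t)) [0..<L] = w"
      using \<tau> len by (intro nth_equalityI) auto
    have "card {k \<in> I. w ! \<sigma> k = A} = card {t. t < L \<and> w ! t = A}" for A
    proof -
      have "{t. t < L \<and> w ! t = A} = {t. t < L \<and> w ! \<sigma> (\<tau> t) = A}" using \<tau>(2) by auto
      then show ?thesis using card_eq[of "\<lambda>k. w ! \<sigma> k = A"] by simp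
    qed
    moreover have "{k \<in> I. (\<lambda>k\<in>I. w ! \<sigma> k) k = A} = {k \<in> I. w ! \<sigma> k = A}" for A by auto
    moreover have "w ! \<sigma> k \<in> D \<and> k \<in> w ! \<sigma> k" if "k \<in> I" for k
      using w \<sigma>[OF that] len nth_mem[of "\<sigma> k" w] by (auto simp: walks)
    ultimately show "(\<lambda>k\<in>I. w ! \<sigma> k) \<in> fillings D I"
      using w by (auto simp: fillings_def walks)
    show "(\<Prod>k\<in>I. x ((\<lambda>k\<in>I. w ! \<sigma> k) k)) = (\<Prod>t<length w. x (w ! t))"
      unfolding len prod.reindex_bij_betw[OF bij, symmetric] using \<tau> by (intro prod.cong) auto
  next
    fix p assume p: "p \<in> fillings D I"
    show "(\<lambda>k\<in>I. map (\<lambda>t. p (\<tau> t)) [0..<L] ! \<sigma> k) = p"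
      using p \<sigma> by (auto simp: fillings_def fun_eq_iff PiE_def extensional_def)
    have pk: "p k \<in> D \<and> k \<in> p k" if "k \<in> I" for k
      using p that by (auto simp: fillings_def PiE_def Pi_def)
    have "{t. t < L \<and> map (\<lambda>t. p (\<tau> t)) [0..<L] ! t = A} = {t. t < L \<and> p (\<tau> t) = A}" for A
      by auto
    then have "card {t. t < L \<and> map (\<lambda>t. p (\<tau> t)) [0..<L] ! t = A} = card {k \<in> I. p k = A}" for A
      using card_eq[of "\<lambda>k. p k = A"] by simp
    then show "map (\<lambda>t. p (\<tau> t)) [0..<L] \<in> walks n D i j"
      using p pk \<tau> by (auto simp: walks fillings_def)
  qed
qed

text \<open>Telescoping: after rescaling by the partial products, a walk with \<open>i < j\<close>
  keeps no edge weight, and one that wraps around keeps the full product once.\<close>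

lemma edge_product:
  fixes q :: "nat \<Rightarrow> 'a::comm_ring_1"
  assumes "i < n" "j < n" "i \<noteq> j"
  shows "(\<Prod>s<i. q s) * (\<Prod>s<ccw_dist n i j. q ((i + s) mod n)) =
    (if i < j then 1 else \<Prod>s<n. q s) * (\<Prod>s<j. q s)"
proof -
  have split: "(\<Prod>s<k. q s) * (\<Prod>s<l - k. q (k + s)) = (\<Prod>s<l. q s)" if "k \<le> l" for k l
  proof -
    have "(\<Prod>s<l. q s) = (\<Prod>s\<in>{..<k}. q s) * (\<Prod>s\<in>{k..<l}. q s)"
      using that by (subst prod.union_disjoint[symmetric]) (auto intro: prod.cong)
    also have "(\<Prod>s\<in>{k..<l}. q s) = (\<Prod>s<l - k. q (k + s))"
      using that by (intro prod.reindex_bij_witness[of _ "\<lambda>s. k + s" "\<lambda>s. s - k"]) auto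
    finally show ?thesis by simp
  qed
  show ?thesis
  proof (cases "i < j")
    case True
    then have "(\<Prod>s<j - i. q ((i + s) mod n)) = (\<Prod>s<j - i. q (i + s))"
      using assms by (intro prod.cong) auto
    then show ?thesis using True split[of i j] by (simp add: ccw_dist_eq[OF assms])
  next
    case False
    have "(\<Prod>s<n + j - i. q ((i + s) mod n)) =
      (\<Prod>s<n - i. q ((i + s) mod n)) * (\<Prod>s\<in>{n - i..<n + j - i}. q ((i + s) mod n))"
      using assms by (subst prod.union_disjoint[symmetric]) (auto intro!: prod.cong)
    also have "(\<Prod>s<n - i. q ((i + s) mod n)) = (\<Prod>s<n - i. q (i + s))"
      using assms by (intro prod.cong) auto
    also have "(\<Prod>s\<in>{n - i..<n + j - i}. q ((i + s) mod n)) = (\<Prod>s<j. q s)"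
      using assms by (intro prod.reindex_bij_witness[of _ "\<lambda>s. s + (n - i)" "\<lambda>s. s - (n - i)"])
        (auto simp: le_mod_geq add.commute)
    finally have "(\<Prod>s<i. q s) * (\<Prod>s<n + j - i. q ((i + s) mod n)) =
      ((\<Prod>s<i. q s) * (\<Prod>s<n - i. q (i + s))) * (\<Prod>s<j. q s)" by (simp add: mult_ac)
    also have "(\<Prod>s<i. q s) * (\<Prod>s<n - i. q (i + s)) = (\<Prod>s<n. q s)"
      using assms by (intro split) auto
    finally show ?thesis using False by (simp add: ccw_dist_eq[OF assms])
  qed
qed

lemma weight_matrix_entry:
  fixes x :: "nat set \<Rightarrow> 'a::comm_ring_1"
  assumes "glued {..<n} D" "i < n" "j < n"
  shows "(\<Prod>s<i. q s) * weight_matrix n D x q $$ (i, j) =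
    entry x D {..<n} (\<Prod>s<n. q s) i j * (\<Prod>s<j. q s)"
proof (cases "i = j")
  case True
  have facts: "finite D" "(\<Sum>A\<in>D. card A - 2) + 2 = n" using glued_facts[OF assms(1)] by auto
  \<comment> \<open>There are no walks from \<open>i\<close> to \<open>i\<close>; on the other side
    \<open>n - 1\<close> vertices meet a total capacity of \<open>n - 2\<close>.\<close>
  have "card (between {..<n} i i) = n - 1"
  proof -
    have "between {..<n} i i = {..<n} - {i}" by (auto simp: between_def)
    then show ?thesis using assms by simp
  qed
  then have "fill_sum x D (between {..<n} i i) = 0"
    using facts by (intro fill_sum_overfull) (auto simp: between_def)
  then show ?thesis using True assms by (simp add: weight_matrix_def walks_def entry_def)
next
  case False
  have "weight_matrix n D x q $$ (i, j) =
    (\<Sum>w\<in>walks n D i j. \<Prod>t<length w. x (w ! t)) * (\<Prod>s<ccw_dist n i j. q ((i + s) mod n))"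
    using assms by (simp add: weight_matrix_def walk_weight_def sum_distrib_right)
  also have "(\<Prod>s<i. q s) * \<dots> = fill_sum x D (between {..<n} i j) *
    ((\<Prod>s<i. q s) * (\<Prod>s<ccw_dist n i j. q ((i + s) mod n)))"
    using False assms by (simp add: sum_walks mult_ac)
  also have "\<dots> = entry x D {..<n} (\<Prod>s<n. q s) i j * (\<Prod>s<j. q s)"
    unfolding edge_product[OF assms(2,3) False] by (simp add: entry_def mult_ac)
  finally show ?thesis .
qed

subsection \<open>The diagonal form\<close>

lemma extend_to_permutation:
  fixes \<sigma> :: "nat \<Rightarrow> nat"
  assumes "inj_on \<sigma> {..<m}" "\<sigma> ` {..<m} \<subseteq> {..<n}"
  obtains \<pi> where "bij_betw \<pi> {..<n} {..<n}" "\<And>l. l < m \<Longrightarrow> \<pi> l = \<sigma> l"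
proof -
  have card: "card (\<sigma> ` {..<m}) = m" using assms(1) by (simp add: card_image)
  then have "m \<le> n" using card_mono[OF _ assms(2)] by simp
  have "card {m..<n} = card ({..<n} - \<sigma> ` {..<m})"
    using card assms(2) by (simp add: card_Diff_subset)
  then obtain \<rho> where \<rho>: "bij_betw \<rho> {m..<n} ({..<n} - \<sigma> ` {..<m})"
    using finite_same_card_bij[of "{m..<n}" "{..<n} - \<sigma> ` {..<m}"] by auto
  define \<pi> where "\<pi> l = (if l < m then \<sigma> l else \<rho> l)" for l
  have "bij_betw \<pi> {..<m} (\<sigma> ` {..<m})"
    using bij_betw_imageI[OF assms(1) refl] by (rule bij_betw_cong[THEN iffD1, rotated]) (simp add: \<pi>_def)
  moreover have "bij_betw \<pi> {m..<n} ({..<n} - \<sigma> ` {..<m})"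
    using \<rho> by (rule bij_betw_cong[THEN iffD1, rotated]) (simp add: \<pi>_def)
  ultimately have "bij_betw \<pi> ({..<m} \<union> {m..<n}) (\<sigma> ` {..<m} \<union> ({..<n} - \<sigma> ` {..<m}))"
    by (rule bij_betw_combine) auto
  moreover have "{..<m} \<union> {m..<n} = {..<n}" "\<sigma> ` {..<m} \<union> ({..<n} - \<sigma> ` {..<m}) = {..<n}"
    using \<open>m \<le> n\<close> assms(2) by auto
  ultimately have "bij_betw \<pi> {..<n} {..<n}" by simp
  then show ?thesis by (rule that) (simp add: \<pi>_def)
qed

context subring_of
begin

lemma GL_monomial:
  assumes "\<And>l. l < n \<Longrightarrow> \<pi> l < n \<and> \<tau> (\<pi> l) = l" "\<And>i. i < n \<Longrightarrow> \<tau> i < n \<and> \<pi> (\<tau> i) = i"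
    and "\<And>l. l < n \<Longrightarrow> u l \<in> R" "\<And>l. l < n \<Longrightarrow> u' l \<in> R" "\<And>l. l < n \<Longrightarrow> u l * u' l = 1"
  shows "fmat n (\<lambda>l i. if i = \<pi> l then u l else 0) \<in> GL n R" (is "?P \<in> _")
    and "fmat n (\<lambda>i l. if l = \<tau> i then u' l else 0) \<in> GL n R" (is "?Q \<in> _")
proof -
  have PQ: "?P * ?Q = 1\<^sub>m n"
  proof (rule eq_matI)
    fix l k assume "l < dim_row (1\<^sub>m n :: 'a mat)" "k < dim_col (1\<^sub>m n :: 'a mat)"
    then have lk: "l < n" "k < n" by auto
    have "(?P * ?Q) $$ (l, k) = (\<Sum>i<n. (if i = \<pi> l then u l else 0) * (if k = \<tau> i then u' k else 0))"
      using lk by (simp add: scalar_prod_def atLeast0LessThan)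
    also have "\<dots> = (\<Sum>i<n. if i = \<pi> l then u l * (if k = \<tau> i then u' k else 0) else 0)"
      by (rule sum.cong) auto
    also have "\<dots> = 1\<^sub>m n $$ (l, k)" using lk assms(1)[OF lk(1)] assms(5) by auto
    finally show "(?P * ?Q) $$ (l, k) = 1\<^sub>m n $$ (l, k)" .
  qed auto
  have QP: "?Q * ?P = 1\<^sub>m n"
  proof (rule eq_matI)
    fix i k assume "i < dim_row (1\<^sub>m n :: 'a mat)" "k < dim_col (1\<^sub>m n :: 'a mat)"
    then have ik: "i < n" "k < n" by auto
    have "(?Q * ?P) $$ (i, k) = (\<Sum>l<n. (if l = \<tau> i then u' l else 0) * (if k = \<pi> l then u l else 0))"
      using ik by (simp add: scalar_prod_def atLeast0LessThan)
    also have "\<dots> = (\<Sum>l<n. if l = \<tau> i then u' l * (if k = \<pi> l then u l else 0) else 0)"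
      by (rule sum.cong) auto
    also have "\<dots> = 1\<^sub>m n $$ (i, k)" using ik assms(2)[OF ik(1)] assms(5) by (auto simp: mult.commute)
    finally show "(?Q * ?P) $$ (i, k) = 1\<^sub>m n $$ (i, k)" .
  qed auto
  have "?P \<in> mats_over n R" "?Q \<in> mats_over n R"
    using assms(3,4) by (auto intro!: mats_overI zero_in)
  then show "?P \<in> GL n R" "?Q \<in> GL n R" using PQ QP GL_I by blast+
qed

text \<open>Not an instance of \<open>eqv\<close>: removing the units \<open>w\<close> and permuting
  rows and columns may change the determinant.\<close>

lemma rearrange_diagonal:
  assumes "inj_on \<sigma> {..<m}" "\<sigma> ` {..<m} \<subseteq> {..<n}" "\<And>i. i < n \<Longrightarrow> unit_in (w i)"
    and "\<And>l. l < m \<Longrightarrow> f (\<sigma> l) = g l" "\<And>i. i < n \<Longrightarrow> i \<notin> \<sigma> ` {..<m} \<Longrightarrow> f i = 1"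
  shows "\<exists>P\<in>GL n R. \<exists>Q\<in>GL n R.
    P * mat_diag n (\<lambda>i. w i * f i) * Q = mat_diag n (\<lambda>l. if l < m then g l else 1)"
proof -
  obtain \<pi> where \<pi>: "bij_betw \<pi> {..<n} {..<n}" "\<And>l. l < m \<Longrightarrow> \<pi> l = \<sigma> l"
    using extend_to_permutation[OF assms(1,2)] by blast
  define \<tau> where "\<tau> = the_inv_into {..<n} \<pi>"
  have \<pi>\<tau>: "\<pi> l < n \<and> \<tau> (\<pi> l) = l" "\<tau> l < n \<and> \<pi> (\<tau> l) = l" if "l < n" for l
    using that \<pi>(1) f_the_inv_into_f_bij_betw[OF \<pi>(1)] bij_betw_the_inv_into[OF \<pi>(1)]
    by (auto simp: \<tau>_def bij_betw_def the_inv_into_f_f)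
  have "\<exists>v\<in>R. w i * v = 1" if "i < n" for i using assms(3)[OF that] by (simp add: unit_in_def)
  then obtain v where v: "\<And>i. i < n \<Longrightarrow> v i \<in> R \<and> w i * v i = 1" by metis
  have w: "w i \<in> R" if "i < n" for i using assms(3)[OF that] by (simp add: unit_in_def)
  \<comment> \<open>\<open>?P\<close> permutes the rows and divides out the units; \<open>?Q\<close>
    only undoes the permutation on the columns.\<close>
  let ?P = "fmat n (\<lambda>l i. if i = \<pi> l then v (\<pi> l) else 0)"
  let ?Q = "fmat n (\<lambda>i l. if l = \<tau> i then 1 else 0)"
  have "?P \<in> GL n R"
    by (rule GL_monomial(1)[of n \<pi> \<tau> "\<lambda>l. v (\<pi> l)" "\<lambda>l. w (\<pi> l)"]) (use \<pi>\<tau> v w in \<open>auto simp: mult.commute\<close>)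
  moreover have "?Q \<in> GL n R"
    by (rule GL_monomial(2)[of n \<pi> \<tau> "\<lambda>l. 1" "\<lambda>l. 1"]) (use \<pi>\<tau> one_in in auto)
  moreover have "?P * mat_diag n (\<lambda>i. w i * f i) * ?Q = mat_diag n (\<lambda>l. if l < m then g l else 1)"
  proof (rule eq_matI)
    fix l k assume "l < dim_row (mat_diag n (\<lambda>l. if l < m then g l else 1))"
      "k < dim_col (mat_diag n (\<lambda>l. if l < m then g l else 1))"
    then have lk: "l < n" "k < n" by (auto simp: mat_diag_def)
    have "(?P * mat_diag n (\<lambda>i. w i * f i) * ?Q) $$ (l, k) =
      (\<Sum>i<n. ((if i = \<pi> l then v (\<pi> l) else 0) * (w i * f i)) * (if k = \<tau> i then 1 else 0))"
      using lk by (subst mat_diag_mult_right[of _ n]) (auto simp: scalar_prod_def atLeast0LessThan)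
    also have "\<dots> = (\<Sum>i<n. if i = \<pi> l then v (\<pi> l) * (w i * f i) * (if k = \<tau> i then 1 else 0) else 0)"
      by (rule sum.cong) auto
    also have "\<dots> = (if k = l then (w (\<pi> l) * v (\<pi> l)) * f (\<pi> l) else 0)"
      using lk \<pi>\<tau>[OF lk(1)] by (auto simp: mult_ac)
    also have "\<dots> = (if k = l then f (\<pi> l) else 0)" using v \<pi>\<tau>[OF lk(1)] by simp
    also have "f (\<pi> l) = (if l < m then g l else 1)"
    proof (cases "l < m")
      case True
      then show ?thesis using \<pi>(2) assms(4) by simp
    next
      case False
      have "\<pi> l \<notin> \<sigma> ` {..<m}"
      proof
        assume "\<pi> l \<in> \<sigma> ` {..<m}"
        then obtain l' where l': "l' < m" "\<pi> l = \<pi> l'" using \<pi>(2) by fastforce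
        then have "l' < n" using lk False by simp
        then have "l = l'" using l' lk \<pi>\<tau> by metis
        then show False using l' False by simp
      qed
      then show ?thesis using False assms(5) \<pi>\<tau>[OF lk(1)] by simp
    qed
    finally show "(?P * mat_diag n (\<lambda>i. w i * f i) * ?Q) $$ (l, k) =
      mat_diag n (\<lambda>l. if l < m then g l else 1) $$ (l, k)"
      using lk by (auto simp: mat_diag_def)
  qed (auto simp: mat_diag_def)
  ultimately show ?thesis by blast
qed

lemma eqv_det:
  assumes "eqv n M N"
  shows "det (fmat n M) = det (fmat n N)"
proof -
  from assms obtain P Q where PQ: "P \<in> GL n R" "Q \<in> GL n R" "det P * det Q = 1"
    "P * fmat n M * Q = fmat n N" unfolding eqv_def by auto
  note c = PQ(1,2)[THEN GL_carrier]
  have "det (fmat n N) = det P * det (fmat n M) * det Q"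
    unfolding PQ(4)[symmetric] using c by (simp add: det_mult[of _ n])
  also have "\<dots> = (det P * det Q) * det (fmat n M)" by (simp only: mult_ac)
  finally show ?thesis using PQ(3) by simp
qed

text \<open>The determinant is read off from the diagonal that still carries the units, whose
  product is the sign times the total edge weight; only then are the units discarded.\<close>

lemma weight_matrix_diagonalization:
  fixes \<alpha> :: "nat \<Rightarrow> nat set"
  assumes D: "glued {..<n} D" "bij_betw \<alpha> {..<m} D"
    and units: "\<And>i. i < n \<Longrightarrow> unit_in (q i)" "\<And>A. A \<in> D \<Longrightarrow> unit_in (x A)"
  defines "\<epsilon> \<equiv> \<Prod>i<n. q i"
  shows "det (weight_matrix n D x q) = (-1) ^ (n - 1) * \<epsilon> * (\<Prod>l<m. piece_factor x D \<epsilon> (\<alpha> l))"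
    and "\<exists>P\<in>GL n R. \<exists>Q\<in>GL n R. P * weight_matrix n D x q * Q =
      mat_diag n (\<lambda>l. if l < m then piece_factor x D \<epsilon> (\<alpha> l) else 1)"
proof -
  let ?W = "weight_matrix n D x q"
  let ?f = "piece_factor x D \<epsilon>"
  have W: "?W = fmat n (\<lambda>i j. ?W $$ (i, j))" by (intro eq_matI) (auto simp: weight_matrix_def)
  have "unit_in \<epsilon>" unfolding \<epsilon>_def using units by (intro unit_in_prod) auto
  define u where "u i = (\<Prod>s<i. q s)" for i
  have "unit_in (u i)" if "i < n" for i
    unfolding u_def using that units by (intro unit_in_prod) auto
  then have u_in: "u i \<in> R" and "\<exists>v\<in>R. u i * v = 1" if "i < n" for i
    using that by (auto simp: unit_in_def)
  then obtain u' where u': "\<And>i. i < n \<Longrightarrow> u' i \<in> R \<and> u i * u' i = 1" by metis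
  obtain h w where h: "inj_on h D" "h ` D \<subseteq> {..<n}" and w: "\<forall>i\<in>{..<n}. unit_in (w i)"
    "(\<Prod>i\<in>{..<n}. w i) = (-1) ^ (card {..<n} - 1) * \<epsilon>" and
    eqv: "eqv n (framed {..<n} (entry x D {..<n} \<epsilon>) (\<lambda>_. 0)) (framed {} (\<lambda>_ _. 0)
      (\<lambda>i. if i \<in> {..<n} then w i * (\<Prod>A\<in>{A \<in> D. h A = i}. ?f A) else 0))"
  proof -
    from D(1) subset_refl \<open>unit_in \<epsilon>\<close> units(2)
    have "\<exists>h w. inj_on h D \<and> h ` D \<subseteq> {..<n} \<and> (\<forall>i\<in>{..<n}. unit_in (w i)) \<and>
      (\<Prod>i\<in>{..<n}. w i) = (-1) ^ (card {..<n} - 1) * \<epsilon> \<and>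
      eqv n (framed {..<n} (entry x D {..<n} \<epsilon>) (\<lambda>_. 0)) (framed {} (\<lambda>_ _. 0)
        (\<lambda>i. if i \<in> {..<n} then w i * (\<Prod>A\<in>{A \<in> D. h A = i}. ?f A) else 0))"
      by (rule eqv_glued)
    then show thesis by (elim exE conjE) (rule that)
  qed
  define f where "f i = (\<Prod>A\<in>{A \<in> D. h A = i}. ?f A)" for i
  have "eqv n (\<lambda>i j. ?W $$ (i, j)) (\<lambda>i j. u i * ?W $$ (i, j) * u' j)"
    using u_in u' by (intro eqv_scale) auto
  also have "eqv n \<dots> (framed {..<n} (entry x D {..<n} \<epsilon>) (\<lambda>_. 0))"
  proof (rule eqv_cong)
    fix i j assume ij: "i < n" "j < n"
    have "u i * ?W $$ (i, j) * u' j = entry x D {..<n} \<epsilon> i j * (u j * u' j)"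
      unfolding u_def \<epsilon>_def weight_matrix_entry[OF D(1) ij] by (simp only: mult.assoc)
    then show "u i * ?W $$ (i, j) * u' j = framed {..<n} (entry x D {..<n} \<epsilon>) (\<lambda>_. 0) i j"
      using ij u' by (simp add: framed_def)
  qed
  also note eqv
  finally have eqv: "eqv n (\<lambda>i j. ?W $$ (i, j)) (\<lambda>i j. if i = j then w i * f i else 0)"
    by (rule eqv_cong_trans) (simp add: framed_def f_def)
  have diag: "fmat n (\<lambda>i j. if i = j then w i * f i else 0) = mat_diag n (\<lambda>i. w i * f i)"
    by (intro eq_matI) (auto simp: mat_diag_def)
  have fin: "finite D" using glued_facts[OF D(1)] by simp
  have "det ?W = (\<Prod>i<n. w i * f i)"
    using eqv_det[OF eqv] unfolding W[symmetric] diag det_mat_diag .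
  also have "\<dots> = (\<Prod>i<n. w i) * (\<Prod>i<n. f i)" by (rule prod.distrib)
  also have "(\<Prod>i<n. f i) = (\<Prod>A\<in>D. ?f A)"
    unfolding f_def by (rule prod.group[OF fin finite_lessThan h(2)])
  also have "\<dots> = (\<Prod>l<m. ?f (\<alpha> l))"
    by (rule prod.reindex_bij_betw[OF D(2), symmetric])
  finally show "det ?W = (-1) ^ (n - 1) * \<epsilon> * (\<Prod>l<m. ?f (\<alpha> l))"
    using w(2) by simp
  have \<alpha>: "\<alpha> l \<in> D" if "l < m" for l using D(2) that by (auto simp: bij_betw_def)
  have f\<alpha>: "f (h (\<alpha> l)) = ?f (\<alpha> l)" if "l < m" for l
  proof -
    have "{A \<in> D. h A = h (\<alpha> l)} = {\<alpha> l}" using h(1) \<alpha>[OF that] by (auto simp: inj_on_def)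
    then show ?thesis by (simp add: f_def)
  qed
  have "f i = 1" if "i \<notin> (h \<circ> \<alpha>) ` {..<m}" for i
  proof -
    have "D = \<alpha> ` {..<m}" using D(2) by (simp add: bij_betw_def)
    then have "{A \<in> D. h A = i} = {}" using that by auto
    then show ?thesis unfolding f_def by (simp only: prod.empty)
  qed
  note f_off = this
  have "inj_on (h \<circ> \<alpha>) {..<m}" "(h \<circ> \<alpha>) ` {..<m} \<subseteq> {..<n}"
    using h D(2) by (auto simp: bij_betw_def intro!: comp_inj_on)
  then have "\<exists>P\<in>GL n R. \<exists>Q\<in>GL n R.
    P * mat_diag n (\<lambda>i. w i * f i) * Q = mat_diag n (\<lambda>l. if l < m then ?f (\<alpha> l) else 1)"
    by (rule rearrange_diagonal) (use w(1) f\<alpha> f_off in simp_all)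
  then obtain P' Q' where 2: "P' \<in> GL n R" "Q' \<in> GL n R"
    "P' * mat_diag n (\<lambda>i. w i * f i) * Q' = mat_diag n (\<lambda>l. if l < m then ?f (\<alpha> l) else 1)"
    by (elim bexE) (rule that)
  from eqv obtain P Q where 1: "P \<in> GL n R" "Q \<in> GL n R"
    "P * ?W * Q = mat_diag n (\<lambda>i. w i * f i)"
    unfolding eqv_def W[symmetric] diag by (elim bexE conjE) (rule that)
  note c = 1(1,2)[THEN GL_carrier] 2(1,2)[THEN GL_carrier]
  have "?W \<in> carrier_mat n n" by (simp add: weight_matrix_def)
  then have "(P' * P) * ?W * (Q * Q') = P' * (P * ?W * Q) * Q'"
    using c by (smt (verit) assoc_mult_mat mult_carrier_mat)
  also have "\<dots> = mat_diag n (\<lambda>l. if l < m then ?f (\<alpha> l) else 1)"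
    unfolding 1(3) by (rule 2(3))
  finally show "\<exists>P\<in>GL n R. \<exists>Q\<in>GL n R. P * ?W * Q =
      mat_diag n (\<lambda>l. if l < m then ?f (\<alpha> l) else 1)"
    by (intro bexI[OF _ GL_mult[OF 2(1) 1(1)]] bexI[OF _ GL_mult[OF 1(2) 2(2)]])
qed

end

subsection \<open>Laurent polynomials\<close>

lemma laurent_ring_I:
  "(\<And>e. e \<in> Poly_Mapping.keys f \<Longrightarrow> Poly_Mapping.keys e \<subseteq> XVar ` {..<m} \<union> QVar ` {..<n}) \<Longrightarrow> f \<in> laurent_ring m n"
  by (simp add: laurent_ring_def)

lemma laurent_ring_D:
  "f \<in> laurent_ring m n \<Longrightarrow> e \<in> Poly_Mapping.keys f \<Longrightarrow> Poly_Mapping.keys e \<subseteq> XVar ` {..<m} \<union> QVar ` {..<n}"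
  by (simp add: laurent_ring_def)

lemma subring_of_laurent_ring: "subring_of (laurent_ring m n)"
proof
  show "0 \<in> laurent_ring m n" "1 \<in> laurent_ring m n"
    by (rule laurent_ring_I, simp)+
next
  fix f g :: laurent assume f: "f \<in> laurent_ring m n" and g: "g \<in> laurent_ring m n"
  show "f + g \<in> laurent_ring m n"
  proof (rule laurent_ring_I)
    fix e assume "e \<in> Poly_Mapping.keys (f + g)"
    then have "e \<in> Poly_Mapping.keys f \<or> e \<in> Poly_Mapping.keys g"
      using keys_add[of f g] by (meson Un_iff subsetD)
    then show "Poly_Mapping.keys e \<subseteq> XVar ` {..<m} \<union> QVar ` {..<n}"
      using laurent_ring_D f g by metis
  qed
  show "f * g \<in> laurent_ring m n"
  proof (rule laurent_ring_I)
    fix e assume "e \<in> Poly_Mapping.keys (f * g)"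
    then obtain a b where e: "e = a + b" "a \<in> Poly_Mapping.keys f" "b \<in> Poly_Mapping.keys g"
      using keys_mult[of f g] by (auto dest!: subsetD)
    have "Poly_Mapping.keys e \<subseteq> Poly_Mapping.keys a \<union> Poly_Mapping.keys b"
      unfolding e(1) by (rule keys_add)
    also have "\<dots> \<subseteq> XVar ` {..<m} \<union> QVar ` {..<n}"
      using laurent_ring_D[OF f e(2)] laurent_ring_D[OF g e(3)] by (rule Un_least)
    finally show "Poly_Mapping.keys e \<subseteq> XVar ` {..<m} \<union> QVar ` {..<n}" .
  qed
next
  fix f :: laurent assume f: "f \<in> laurent_ring m n"
  show "- f \<in> laurent_ring m n"
  proof (rule laurent_ring_I)
    fix e assume "e \<in> Poly_Mapping.keys (- f)"
    then have "e \<in> Poly_Mapping.keys f" by (simp add: in_keys_iff)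
    then show "Poly_Mapping.keys e \<subseteq> XVar ` {..<m} \<union> QVar ` {..<n}" by (rule laurent_ring_D[OF f])
  qed
qed

lemma Var_inverse: "Var v * Poly_Mapping.single (Poly_Mapping.single v (-1)) 1 = 1"
  by (simp add: Var_def mult_single single_add[symmetric])

lemma Var_unit:
  assumes "v \<in> XVar ` {..<m} \<union> QVar ` {..<n}"
  shows "subring_of.unit_in (laurent_ring m n) (Var v)"
proof -
  interpret subring_of "laurent_ring m n" by (rule subring_of_laurent_ring)
  have in_R: "Poly_Mapping.single (Poly_Mapping.single v k) 1 \<in> laurent_ring m n" for k
  proof (rule laurent_ring_I)
    fix e assume "e \<in> Poly_Mapping.keys (Poly_Mapping.single (Poly_Mapping.single v k) (1 :: int))"
    then have "Poly_Mapping.keys e \<subseteq> {v}" by simp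
    also have "\<dots> \<subseteq> XVar ` {..<m} \<union> QVar ` {..<n}" using assms by (rule insert_subsetI) (rule empty_subsetI)
    finally show "Poly_Mapping.keys e \<subseteq> XVar ` {..<m} \<union> QVar ` {..<n}" .
  qed
  show ?thesis unfolding unit_in_def
  proof (intro conjI)
    show "Var v \<in> laurent_ring m n" unfolding Var_def by (rule in_R)
    show "\<exists>g\<in>laurent_ring m n. Var v * g = 1" by (rule bexI[OF _ in_R]) (rule Var_inverse)
  qed
qed

text \<open>Nonnegative exponents rule out cancellation, so a product containing an indeterminate
  cannot be 1. This keeps the denominators of the quotient formula nonzero.\<close>

definition monomials :: "laurent set" where
  "monomials = {Poly_Mapping.single e 1 | e. \<forall>v. 0 \<le> Poly_Mapping.lookup e v}"

lemma one_monomial: "1 \<in> monomials"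
  unfolding monomials_def by (rule CollectI, rule exI[of _ 0]) simp

lemma mult_monomial:
  assumes "f \<in> monomials" "g \<in> monomials"
  shows "f * g \<in> monomials"
proof -
  from assms obtain a b where "f = Poly_Mapping.single a 1" "g = Poly_Mapping.single b 1"
    and ab: "\<And>v. 0 \<le> Poly_Mapping.lookup a v" "\<And>v. 0 \<le> Poly_Mapping.lookup b v"
    unfolding monomials_def by blast
  then have "f * g = Poly_Mapping.single (a + b) 1" by (simp add: mult_single)
  moreover have "0 \<le> Poly_Mapping.lookup (a + b) v" for v
    using ab[of v] by (simp add: lookup_add)
  ultimately show ?thesis unfolding monomials_def by blast
qed

lemma Var_monomial: "Var v \<in> monomials"
  unfolding monomials_def Var_def
  by (rule CollectI, rule exI[of _ "Poly_Mapping.single v 1"]) (simp add: lookup_single when_def)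

lemma power_monomial: "f \<in> monomials \<Longrightarrow> f ^ k \<in> monomials"
  by (induction k) (auto intro: one_monomial mult_monomial)

lemma prod_monomial: "(\<And>k. k \<in> S \<Longrightarrow> f k \<in> monomials) \<Longrightarrow> prod f S \<in> monomials"
  by (induction S rule: infinite_finite_induct) (auto intro: one_monomial mult_monomial)

lemma Var_mult_monomial_neq_one:
  assumes "f \<in> monomials"
  shows "Var v * f \<noteq> 1"
proof
  assume *: "Var v * f = 1"
  obtain e where e: "f = Poly_Mapping.single e 1" "\<And>v. 0 \<le> Poly_Mapping.lookup e v"
    using assms unfolding monomials_def by auto
  then have "Poly_Mapping.single (Poly_Mapping.single v 1 + e) (1 :: int) = Poly_Mapping.single 0 1"
    using * by (simp add: Var_def mult_single)
  then have "Poly_Mapping.keys (Poly_Mapping.single (Poly_Mapping.single v 1 + e) (1 :: int)) =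
    Poly_Mapping.keys (Poly_Mapping.single 0 (1 :: int))" by (rule arg_cong)
  then have "Poly_Mapping.single v 1 + e = 0" by simp
  then have "Poly_Mapping.lookup (Poly_Mapping.single v 1 + e) v = 0" by simp
  then show False using e(2)[of v] by (simp add: lookup_add)
qed

lemma to_fract_prod: "to_fract (\<Prod>k\<in>S. f k) = (\<Prod>k\<in>S. to_fract (f k))"
  by (induction S rule: infinite_finite_induct) simp_all

lemma to_fract_geometric_sum:
  assumes "z \<noteq> 1" "2 \<le> d"
  shows "to_fract (\<Sum>j=0..d - 2. z ^ j) = to_fract (z ^ (d - 1) - 1) / to_fract (z - 1)"
proof -
  \<comment> \<open>For \<open>2 \<le> d\<close> the truncated subtractions are genuine, so the sum
    has \<open>d - 1\<close> terms.\<close>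
  have "Suc (d - 2) = d - 1" using assms(2) by simp
  then have "(z - 1) * (\<Sum>j=0..d - 2. z ^ j) = z ^ (d - 1) - 1"
    using power_diff_1_eq[of z "d - 1"] by (simp add: lessThan_Suc_atMost[symmetric] atLeast0AtMost)
  then have "to_fract (\<Sum>j=0..d - 2. z ^ j) * to_fract (z - 1) = to_fract (z ^ (d - 1) - 1)"
    by (metis mult.commute to_fract_mult)
  moreover have "to_fract (z - 1) \<noteq> 0" using assms(1) by (simp del: to_fract_diff)
  ultimately show ?thesis by (metis nonzero_mult_div_cancel_right)
qed

theorem theorem4p4:
  fixes n m :: nat
    and E :: "(nat \<times> nat) set"
    and \<alpha> :: "nat \<Rightarrow> nat set"
    and d :: "nat \<Rightarrow> nat"
    and x :: "nat set \<Rightarrow> laurent"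
    and q :: "nat \<Rightarrow> laurent"
    and c \<epsilon> :: laurent
  assumes "3 \<le> n"
    and "dissection n E"
    and "bij_betw \<alpha> {..<m} (pieces n E)"
    and "\<And>l. l < m \<Longrightarrow> d l = card (\<alpha> l)"
    and "\<And>l. l < m \<Longrightarrow> x (\<alpha> l) = Var (XVar l)"
    and "\<And>i. i < n \<Longrightarrow> q i = Var (QVar i)"
    and "c = (\<Prod>l<m. Var (XVar l) ^ (d l - 2))"
    and "\<epsilon> = (\<Prod>i<n. Var (QVar i))"
  shows "det (weight_matrix n (pieces n E) x q) =
           (-1) ^ (n - 1) * \<epsilon> * (\<Prod>l<m. \<Sum>j=0..d l - 2. (\<epsilon> * c * Var (XVar l) ^ 2) ^ j)
       \<and> to_fract (det (weight_matrix n (pieces n E) x q)) =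
           to_fract ((-1) ^ (n - 1) * \<epsilon>) *
           (\<Prod>l<m. to_fract ((\<epsilon> * c * Var (XVar l) ^ 2) ^ (d l - 1) - 1) /
                    to_fract (\<epsilon> * c * Var (XVar l) ^ 2 - 1))
       \<and> (\<exists>P \<in> GL n (laurent_ring m n). \<exists>Q \<in> GL n (laurent_ring m n).
            P * weight_matrix n (pieces n E) x q * Q =
              mat_diag n (\<lambda>l. if l < m then \<Sum>j=0..d l - 2. (\<epsilon> * c * Var (XVar l) ^ 2) ^ j
                               else 1))"
proof -
  interpret subring_of "laurent_ring m n" by (rule subring_of_laurent_ring)
  let ?D = "pieces n E"
  let ?z = "\<lambda>l. \<epsilon> * c * Var (XVar l) ^ 2"
  have D: "glued {..<n} ?D" using assms(1,2) by (rule glued_pieces)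
  have \<alpha>: "\<alpha> l \<in> ?D" if "l < m" for l using assms(3) that by (auto simp: bij_betw_def)
  have d: "3 \<le> d l" if "l < m" for l using glued_facts[OF D] \<alpha>[OF that] assms(4)[OF that] by auto
  have q: "unit_in (q i)" if "i < n" for i using that assms(6) by (auto intro: Var_unit)
  have x: "unit_in (x A)" if A: "A \<in> ?D" for A
  proof -
    obtain l where "l < m" "A = \<alpha> l" using assms(3) A by (auto simp: bij_betw_def)
    then show ?thesis using assms(5) by (auto intro: Var_unit)
  qed
  have \<epsilon>: "(\<Prod>i<n. q i) = \<epsilon>" using assms(6,8) by simp
  have "c_weight x ?D = (\<Prod>l<m. x (\<alpha> l) ^ (card (\<alpha> l) - 2))"
    unfolding c_weight_def by (rule prod.reindex_bij_betw[OF assms(3), symmetric])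
  also have "\<dots> = c" unfolding assms(7) using assms(4,5) by (intro prod.cong) auto
  finally have f: "piece_factor x ?D \<epsilon> (\<alpha> l) = (\<Sum>j=0..d l - 2. ?z l ^ j)" if "l < m" for l
    using that assms(4,5) by (simp add: piece_factor_def)
  from D assms(3) q x have main_det: "det (weight_matrix n ?D x q) =
      (-1) ^ (n - 1) * (\<Prod>i<n. q i) * (\<Prod>l<m. piece_factor x ?D (\<Prod>i<n. q i) (\<alpha> l))"
    by (rule weight_matrix_diagonalization(1))
  from D assms(3) q x have main_diag: "\<exists>P\<in>GL n (laurent_ring m n). \<exists>Q\<in>GL n (laurent_ring m n).
      P * weight_matrix n ?D x q * Q =
      mat_diag n (\<lambda>l. if l < m then piece_factor x ?D (\<Prod>i<n. q i) (\<alpha> l) else 1)"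
    by (rule weight_matrix_diagonalization(2))
  have det: "det (weight_matrix n ?D x q) = (-1) ^ (n - 1) * \<epsilon> * (\<Prod>l<m. \<Sum>j=0..d l - 2. ?z l ^ j)"
    using main_det f unfolding \<epsilon> by simp
  have "?z l \<noteq> 1" for l
  proof -
    \<comment> \<open>Splitting off the last edge variable leaves a product of monomials, so
      \<open>?z l\<close> is a nontrivial monomial.\<close>
    obtain k where k: "n = Suc k" using assms(1) by (cases n) auto
    have "?z l = Var (QVar k) * ((\<Prod>i<k. Var (QVar i)) * c * Var (XVar l) ^ 2)"
      unfolding assms(8) k by (simp add: mult_ac)
    moreover have "(\<Prod>i<k. Var (QVar i)) * c * Var (XVar l) ^ 2 \<in> monomials"
      unfolding assms(7) by (intro mult_monomial prod_monomial power_monomial Var_monomial)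
    ultimately show ?thesis using Var_mult_monomial_neq_one by metis
  qed
  then have "to_fract (\<Sum>j=0..d l - 2. ?z l ^ j) = to_fract (?z l ^ (d l - 1) - 1) / to_fract (?z l - 1)"
    if "l < m" for l using d[OF that] by (intro to_fract_geometric_sum) auto
  then have "to_fract (det (weight_matrix n ?D x q)) = to_fract ((-1) ^ (n - 1) * \<epsilon>) *
    (\<Prod>l<m. to_fract (?z l ^ (d l - 1) - 1) / to_fract (?z l - 1))"
    unfolding det to_fract_mult[of "(-1) ^ (n - 1) * \<epsilon>"] to_fract_prod
    by (intro arg_cong[of _ _ "(*) _"] prod.cong) auto
  moreover have "mat_diag n (\<lambda>l. if l < m then piece_factor x ?D \<epsilon> (\<alpha> l) else 1) =
    mat_diag n (\<lambda>l. if l < m then \<Sum>j=0..d l - 2. ?z l ^ j else 1)"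
    using f by (intro arg_cong[of _ _ "mat_diag n"]) auto
  ultimately show ?thesis using det main_diag unfolding \<epsilon> by simp
qed

end
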